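(* Let $A$ be a finite-dimensional basic algebra over an algebraically closed field $\Bbbk$, and let $X$ be a finite-dimensional left $A$-module. Then the function $\operatorname{JF}$ on $\operatorname{NEnd}(X)$ has a maximum value with respect to componentwise dominance order (i.e. there is ${\boldsymbol\mu}$ with $\operatorname{JF}(N)\le{\boldsymbol\mu}$ for all $N\in\operatorname{NEnd}(X)$), and the set of $N\in\operatorname{NEnd}(X)$ with $\operatorname{JF}(N)={\boldsymbol\mu}$ is a dense open subset of $\operatorname{NEnd}(X)$.
   Context: $A$ is identified with a quiver $Q$ with relations (vertices $1,\dots,n$ corresponding to a complete set of primitive orthogonal idempotents $e_i$), so $X$ corresponds to a representation with vector spaces $X_i=e_iX$ of dimension $d_i$. $\operatorname{NEnd}(X)$ is the variety of nilpotent $A$-module endomorphisms of $X$. For $N\in\operatorname{NEnd}(X)$, $N_i$ is the induced operator on $X_i$, $\operatorname{JF}(N_i)\vdash d_i$ the partition of Jordan block sizes, and $\operatorname{JF}(N)=(\operatorname{JF}(N_i))_i$. For partitions $\gamma,\kappa$ of the same integer, $\gamma\le\kappa$ in dominance order if $\gamma_1+\dots+\gamma_k\le\kappa_1+\dots+\kappa_k$ for all $k$; for tuples, ${\boldsymbol\lambda}\le{\boldsymbol\mu}$ iff $\lambda^i\le\mu^i$ for every $i$. *)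

theory Defs
  imports "HOL-Analysis.Analysis" "Jordan_Normal_Form.Jordan_Normal_Form"
begin

definition alg_closed_field :: "'k::field itself \<Rightarrow> bool" where
  "alg_closed_field _ \<longleftrightarrow> (\<forall>p :: 'k poly. degree p > 0 \<longrightarrow> (\<exists>x. poly p x = 0))"

text \<open>Quiver with vertices 0..<n and a finite set E of arrows (source src, target tgt);
  a representation X assigns to vertex i the space k^(d i) and to an arrow e a matrix
  X e of size d(tgt e) x d(src e) (the map X_(src e) -> X_(tgt e)).\<close>
definition is_rep :: "nat \<Rightarrow> 'e set \<Rightarrow> ('e \<Rightarrow> nat) \<Rightarrow> ('e \<Rightarrow> nat) \<Rightarrow> (nat \<Rightarrow> nat)
    \<Rightarrow> ('e \<Rightarrow> 'k::field mat) \<Rightarrow> bool" where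
  "is_rep n E src tgt d X \<longleftrightarrow> finite E \<and>
     (\<forall>e\<in>E. src e < n \<and> tgt e < n \<and> X e \<in> carrier_mat (d (tgt e)) (d (src e)))"

text \<open>Endomorphisms of the representation X (= A-module endomorphisms of X),
  as tuples (N_0,...,N_(n-1)) of square matrices; components outside the vertex set are
  fixed to be the empty matrix so that each endomorphism has a unique representation.\<close>
definition End_rep :: "nat \<Rightarrow> 'e set \<Rightarrow> ('e \<Rightarrow> nat) \<Rightarrow> ('e \<Rightarrow> nat) \<Rightarrow> (nat \<Rightarrow> nat)
    \<Rightarrow> ('e \<Rightarrow> 'k::field mat) \<Rightarrow> (nat \<Rightarrow> 'k mat) set" where
  "End_rep n E src tgt d X = {N.
     (\<forall>i<n. N i \<in> carrier_mat (d i) (d i)) \<and> (\<forall>i\<ge>n. N i = 0\<^sub>m 0 0) \<and>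
     (\<forall>e\<in>E. N (tgt e) * X e = X e * N (src e))}"

definition nilpotent_mat :: "'k::field mat \<Rightarrow> bool" where
  "nilpotent_mat M \<longleftrightarrow> (\<exists>m. M ^\<^sub>m m = 0\<^sub>m (dim_row M) (dim_col M))"

text \<open>NEnd(X): nilpotent endomorphisms (N is nilpotent iff every N_i is).\<close>
definition NEnd :: "nat \<Rightarrow> 'e set \<Rightarrow> ('e \<Rightarrow> nat) \<Rightarrow> ('e \<Rightarrow> nat) \<Rightarrow> (nat \<Rightarrow> nat)
    \<Rightarrow> ('e \<Rightarrow> 'k::field mat) \<Rightarrow> (nat \<Rightarrow> 'k mat) set" where
  "NEnd n E src tgt d X = {N \<in> End_rep n E src tgt d X. \<forall>i<n. nilpotent_mat (N i)}"

definition JF_mat :: "'k::field mat \<Rightarrow> nat list" where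
  "JF_mat M = rev (sort (map fst (SOME n_as. jordan_nf M n_as)))"

definition JF :: "nat \<Rightarrow> (nat \<Rightarrow> 'k::field mat) \<Rightarrow> (nat \<Rightarrow> nat list)" where
  "JF n N = (\<lambda>i. if i < n then JF_mat (N i) else [])"

definition dominance_le :: "nat list \<Rightarrow> nat list \<Rightarrow> bool" where
  "dominance_le \<gamma> \<kappa> \<longleftrightarrow> (\<forall>k. sum_list (take k \<gamma>) \<le> sum_list (take k \<kappa>))"

definition dominance_le_tuple :: "nat \<Rightarrow> (nat \<Rightarrow> nat list) \<Rightarrow> (nat \<Rightarrow> nat list) \<Rightarrow> bool" where
  "dominance_le_tuple n la mu \<longleftrightarrow> (\<forall>i<n. dominance_le (la i) (mu i))"

inductive_set poly_fun :: "nat \<Rightarrow> (nat \<Rightarrow> nat) \<Rightarrow> ((nat \<Rightarrow> 'k::field mat) \<Rightarrow> 'k) set"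
  for n d where
  const: "(\<lambda>N. c) \<in> poly_fun n d"
| coord: "i < n \<Longrightarrow> r < d i \<Longrightarrow> c < d i \<Longrightarrow> (\<lambda>N. N i $$ (r, c)) \<in> poly_fun n d"
| add: "p \<in> poly_fun n d \<Longrightarrow> q \<in> poly_fun n d \<Longrightarrow> (\<lambda>N. p N + q N) \<in> poly_fun n d"
| mult: "p \<in> poly_fun n d \<Longrightarrow> q \<in> poly_fun n d \<Longrightarrow> (\<lambda>N. p N * q N) \<in> poly_fun n d"

definition zariski :: "nat \<Rightarrow> (nat \<Rightarrow> nat) \<Rightarrow> (nat \<Rightarrow> 'k::field mat) topology" where
  "zariski n d = topology_generated_by {{N. p N \<noteq> 0} | p. p \<in> poly_fun n d}"

end

theory Submission
  imports Defs "Jordan_Normal_Form.Jordan_Normal_Form_Existence" "Jordan_Normal_Form.Jordan_Normal_Form_Uniqueness"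
begin

text \<open>
  Jordan types are governed by the dimensions of the kernels of the powers \<open>N i ^ j\<close>: these
  determine the partial sums of the partition, smaller kernels mean a more dominant partition, and
  a bound from above on a kernel dimension is a Zariski open condition (nonvanishing of a minor).
  Hence everything follows once the variety of nilpotent endomorphisms is irreducible, since then
  the nonempty open loci where the kernel dimensions are minimal meet in a dense open set.

  For irreducibility let \<open>A\<close> be the endomorphism algebra. There is a linear space \<open>U\<close> of nilpotents
  such that every nilpotent is conjugate under \<open>A\<^sup>\<times>\<close> into \<open>U\<close>, so the nilpotents are the image of
  \<open>A\<^sup>\<times> \<times> U\<close>. The space \<open>U\<close> is built without Wedderburn theory by splitting off a local idempotent
  \<open>e\<close>: any nilpotent can be conjugated so as to map \<open>e\<close> into the radical, and what remains is a
  nilpotent of the corner \<open>(1 - e) A (1 - e)\<close>.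
\<close>

section \<open>Nilpotents in a finite-dimensional algebra\<close>

text \<open>Nilpotents do not form a linear space, so irreducibility has to come from a
  parametrisation. In a full matrix algebra \<open>U\<close> would be, up to a change of basis, the
  strictly triangular matrices; in general the flag is replaced by a chain of local idempotents and
  zero entries by radical entries, which do not influence nilpotency. The conjugating unit comes
  from the last column \<open>u = a ^ l * e\<close> outside the radical: it is a copy of
  \<open>e\<close>, while \<open>a * u\<close> lies in the radical, so any unit \<open>g\<close>
  with \<open>g * e = u\<close> works. The obstacle is to extend the column \<open>u\<close> to a
  unit; this is a cancellation property of local summands. Irreducibility is used in the following
  form: two polynomials, each nonzero somewhere on the nilpotents, are nonzero at a common
  nilpotent. A polynomial curve through two given points yields this over an infinite field, and
  algebraic closedness supplies infinitely many parameters. The partition at vertex \<open>i\<close>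
  has size \<open>d i\<close>, so the exponents \<open>j \<le> d i\<close> suffice and only finitely
  many open conditions are intersected.\<close>

definition nilp :: "'a::ring_1 \<Rightarrow> bool" where
  "nilp x \<longleftrightarrow> (\<exists>k. x ^ k = 0)"

lemma mult_power_shift: "x * (y * x) ^ k = (x * y) ^ k * (x::'a::monoid_mult)"
  by (induction k) (simp_all add: mult.assoc)

text \<open>Because \<open>(y * x) ^ Suc k = y * (x * y) ^ k * x\<close>.\<close>

lemma nilp_mult_commute:
  assumes "nilp (x * y)" shows "nilp (y * x)"
proof -
  obtain k where "(x * y) ^ k = 0" using assms by (auto simp: nilp_def)
  then have "(y * x) ^ Suc k = 0"
    using mult_power_shift[of x y k] by (simp add: mult.assoc)
  then show ?thesis unfolding nilp_def by blast
qed

lemma nilp_uminus: "nilp x \<Longrightarrow> nilp (- x)"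
  unfolding nilp_def by (metis mult_zero_right power_minus)

text \<open>The exponent is positive because \<open>a ^ 0 * b ^ 0\<close> is the unit of the whole
  monoid, which may differ from \<open>e\<close>.\<close>

lemma left_inverse_power:
  fixes a b e :: "'a::monoid_mult"
  assumes "a * b = e" "e * b = b" "k > 0"
  shows "a ^ k * b ^ k = e"
  using \<open>k > 0\<close>
proof (induction k rule: nat_induct_non_zero)
  case (Suc k)
  have "a ^ Suc k * b ^ Suc k = a ^ k * (a * b) * b ^ k"
    by (simp only: power_Suc2[of a] power_Suc[of b] mult.assoc)
  also have "\<dots> = a ^ k * (e * b ^ k)" using assms(1) by (simp add: mult.assoc)
  also have "e * b ^ k = b ^ k"
    using Suc.hyps assms(2) by (cases k) (simp_all add: mult.assoc[symmetric])
  finally show ?case using Suc by simp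
qed (use assms in simp)

text \<open>The units that occur are idempotents \<open>f\<close> in \<open>E\<close>, not the unit
  of the ring, so all algebras of the recursion live in one type. The price is that
  \<open>x ^ 0\<close> is the ambient \<open>1\<close>; hence the exponents \<open>Suc k\<close> and
  the trailing factors \<open>e\<close> or \<open>f\<close> below. The ring may be
  infinite-dimensional: finiteness is imposed on \<open>E\<close> alone, through
  \<open>T\<close>.\<close>

locale fd_subalgebra = vector_space scale
  for scale :: "'k::field \<Rightarrow> 'a::ring_1 \<Rightarrow> 'a" (infixr "*\<^sub>K" 75) +
  fixes E T :: "'a set"
  assumes scale_mult_left: "(c *\<^sub>K x) * y = c *\<^sub>K (x * y)"
    and scale_mult_right: "x * (c *\<^sub>K y) = c *\<^sub>K (x * y)"
    and subspace_E: "subspace E"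
    and mult_E: "x \<in> E \<Longrightarrow> y \<in> E \<Longrightarrow> x * y \<in> E"
    and finite_T: "finite T"
    and E_span: "E \<subseteq> span T"
begin

lemma dim_strict_mono:
  assumes "subspace A" "A \<subset> B" "B \<subseteq> E"
  shows "dim A < dim B"
proof -
  obtain b where b: "b \<in> B" "b \<notin> A" using assms by auto
  obtain Ba where Ba: "Ba \<subseteq> A" "independent Ba" "A \<subseteq> span Ba" "card Ba = dim A"
    using basis_exists by blast
  obtain Bb where Bb: "Bb \<subseteq> B" "independent Bb" "B \<subseteq> span Bb" "card Bb = dim B"
    using basis_exists by blast
  have "span Ba \<subseteq> A" using Ba assms(1) span_minimal by blast
  then have "independent (insert b Ba)" 
    using Ba(2) b by (meson independent_insertI subsetD)
  moreover have "insert b Ba \<subseteq> span Bb" using Ba Bb b assms by blast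
  \<comment> \<open>Needed for the comparison of cardinalities, since an infinite set has
    \<open>card\<close> 0.\<close>
  moreover have "finite Bb"
    using independent_span_bound[OF finite_T Bb(2)] Bb(1) assms E_span by blast
  ultimately have "finite (insert b Ba) \<and> card (insert b Ba) \<le> card Bb"
    by (intro independent_span_bound)
  moreover have "b \<notin> Ba" using Ba b by auto
  ultimately show ?thesis using Ba Bb by auto
qed

text \<open>For an idempotent \<open>f\<close> in \<open>E\<close> this is the Peirce corner
  \<open>f E f\<close>, an algebra with unit \<open>f\<close>; given by linear equations, it is
  visibly a subspace.\<close>

definition corner :: "'a \<Rightarrow> 'a set" where
  "corner f = {x \<in> E. f * x = x \<and> x * f = x}"

text \<open>The Jacobson radical of the corner, in the form that it has in finite dimension.
  Nilpotency of its elements is immediate; closure under addition is not.\<close>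

definition radical :: "'a \<Rightarrow> 'a set" where
  "radical f = {x \<in> corner f. \<forall>y \<in> corner f. nilp (y * x)}"

definition idem :: "'a \<Rightarrow> bool" where
  "idem f \<longleftrightarrow> f \<in> E \<and> f * f = f"

lemma idem_corner: "idem f \<Longrightarrow> f \<in> corner f"
  by (simp add: idem_def corner_def)

lemma cornerD: "x \<in> corner f \<Longrightarrow> f * x = x" "x \<in> corner f \<Longrightarrow> x * f = x" "x \<in> corner f \<Longrightarrow> x \<in> E"
  by (auto simp: corner_def)

lemma subspace_corner: "subspace (corner f)"
  using subspace_E unfolding subspace_def corner_def
  by (simp add: distrib_left distrib_right scale_mult_left scale_mult_right)

lemma corner_mult: "x \<in> corner f \<Longrightarrow> y \<in> corner f \<Longrightarrow> x * y \<in> corner f"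
  using mult_E by (simp add: corner_def mult.assoc) (simp add: corner_def flip: mult.assoc)

lemmas corner_add = subspace_add[OF subspace_corner]
  and corner_diff = subspace_diff[OF subspace_corner]
  and corner_0 = subspace_0[OF subspace_corner]
  and corner_scale = subspace_scale[OF subspace_corner]
  and corner_neg = subspace_neg[OF subspace_corner]

lemma corner_power_mult: "x \<in> corner f \<Longrightarrow> y \<in> corner f \<Longrightarrow> x ^ k * y \<in> corner f"
  by (induction k) (simp_all add: corner_mult mult.assoc)

lemma corner_power: "x \<in> corner f \<Longrightarrow> x ^ Suc k \<in> corner f"
  by (induction k) (simp_all add: corner_mult)

lemma corner_mono: "idem e \<Longrightarrow> e \<in> corner f \<Longrightarrow> corner e \<subseteq> corner f"
  unfolding corner_def by (smt (verit) Collect_mono_iff mem_Collect_eq mult.assoc)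

lemma corner_conj: "idem e \<Longrightarrow> x \<in> E \<Longrightarrow> e * x * e \<in> corner e"
  unfolding idem_def corner_def using mult_E by (simp add: mult.assoc) (simp flip: mult.assoc)

lemma idem_diff:
  assumes "idem e" "idem f" "e \<in> corner f"
  shows "idem (f - e)" "f - e \<in> corner f"
  using assms corner_diff[OF idem_corner[OF assms(2)] assms(3)]
  by (auto simp: idem_def corner_def algebra_simps)

text \<open>The subspaces spanned by the powers \<open>x ^ Suc k\<close> with \<open>k \<ge> m\<close> decrease with \<open>m\<close>, so they stabilise.\<close>

lemma power_eq_power_mult:
  assumes "idem e" "x \<in> corner e"
  obtains m y where "y \<in> corner e" "x * y = y * x" "x ^ Suc m = x ^ Suc (Suc m) * y"
proof -
  define S where "S m = span {x ^ Suc k |k. k \<ge> m}" for m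
  have S_E: "S m \<subseteq> E" for m
    unfolding S_def by (rule span_minimal) (use corner_power[OF assms(2)] cornerD(3) subspace_E in blast)+
  obtain m where m: "\<And>l. dim (S m) \<le> dim (S l)"
    using ex_has_least_nat[of "\<lambda>_. True" _ "\<lambda>m. dim (S m)"] by auto
  have "S (Suc m) \<subseteq> S m" unfolding S_def by (rule span_mono) auto
  moreover have "\<not> S (Suc m) \<subset> S m"
  proof
    assume "S (Suc m) \<subset> S m"
    moreover have "subspace (S (Suc m))" unfolding S_def by (rule subspace_span)
    ultimately have "dim (S (Suc m)) < dim (S m)" using dim_strict_mono S_E by blast
    then show False using m[of "Suc m"] by simp
  qed
  ultimately have "S (Suc m) = S m" by blast
  moreover have "x ^ Suc m \<in> S m" unfolding S_def by (rule span_base) auto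
  ultimately have "x ^ Suc m \<in> S (Suc m)" by simp
  \<comment> \<open>The right-hand side is a subspace containing the generators; \<open>y\<close>
    arises as a polynomial in \<open>x\<close> times \<open>e\<close>, hence commutes with
    \<open>x\<close>.\<close>
  moreover have "S (Suc m) \<subseteq> {x ^ Suc (Suc m) * y |y. y \<in> corner e \<and> x * y = y * x}"
    unfolding S_def
  proof (rule span_minimal)
    show "{x ^ Suc k |k. Suc m \<le> k} \<subseteq> {x ^ Suc (Suc m) * y |y. y \<in> corner e \<and> x * y = y * x}"
    proof clarify
      fix k assume "Suc m \<le> k"
      then obtain j where k: "k = Suc m + j" using le_Suc_ex by blast
      have "Suc k = Suc (Suc m) + j" using k by simp
      then have "x ^ Suc k = x ^ (Suc (Suc m) + j) * e"
        using cornerD(2)[OF corner_power[OF assms(2), of k]] by metis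
      \<comment> \<open>The factor \<open>e\<close> keeps the cofactor in the corner when
        \<open>j = 0\<close>.\<close>
      then have "x ^ Suc k = x ^ Suc (Suc m) * (x ^ j * e)"
        by (simp only: power_add mult.assoc)
      moreover have "x ^ j * e \<in> corner e"
        using assms corner_power_mult idem_corner by blast
      moreover have "x * (x ^ j * e) = x ^ j * e * x"
        using cornerD(2)[OF corner_power[OF assms(2), of j]] cornerD(1)[OF assms(2)]
        by (simp add: mult.assoc power_commutes)
      ultimately show "\<exists>y. x ^ Suc k = x ^ Suc (Suc m) * y \<and> y \<in> corner e \<and> x * y = y * x" by blast
    qed
    show "subspace {x ^ Suc (Suc m) * y |y. y \<in> corner e \<and> x * y = y * x}"
    proof (rule subspaceI; clarify)
      show "\<exists>y. 0 = x ^ Suc (Suc m) * y \<and> y \<in> corner e \<and> x * y = y * x"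
        by (rule exI[of _ 0]) (simp add: corner_0)
      fix y assume y: "y \<in> corner e" "x * y = y * x"
      show "\<exists>z. c *\<^sub>K (x ^ Suc (Suc m) * y) = x ^ Suc (Suc m) * z \<and> z \<in> corner e \<and> x * z = z * x" for c
        by (rule exI[of _ "c *\<^sub>K y"]) (simp only: scale_mult_left scale_mult_right y corner_scale simp_thms)
      fix z assume z: "z \<in> corner e" "x * z = z * x"
      show "\<exists>u. x ^ Suc (Suc m) * y + x ^ Suc (Suc m) * z = x ^ Suc (Suc m) * u \<and> u \<in> corner e \<and> x * u = u * x"
        by (rule exI[of _ "y + z"]) (simp only: distrib_left distrib_right y z corner_add simp_thms)
    qed
  qed
  ultimately show ?thesis using that by blast
qed

text \<open>Fitting decomposition: \<open>x * z\<close> projects onto the part where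
  \<open>x\<close> is inverted by \<open>z\<close>, and \<open>x\<close> is nilpotent on the
  complement \<open>e - x * z\<close>. Iterating \<open>x ^ k = x ^ Suc k * y\<close> gives
  \<open>x ^ k = x ^ k * (x ^ k * y ^ k)\<close>, so \<open>x ^ k * y ^ k\<close> is
  idempotent.\<close>

lemma fitting:
  assumes "idem e" "x \<in> corner e"
  obtains z k where "z \<in> corner e" "x * z = z * x" "(x * z) * (x * z) = x * z" "x ^ k * (x * z) = x ^ k"
proof -
  obtain m y where y: "y \<in> corner e" "x * y = y * x" "x ^ Suc m = x ^ Suc (Suc m) * y"
    using power_eq_power_mult assms by blast
  let ?k = "Suc m"
  have "x ^ ?k * (x ^ j * y ^ j) = x ^ ?k" for j
  proof (induction j)
    case (Suc j)
    have "x ^ ?k * (x ^ Suc j * y ^ Suc j) = x ^ j * (x ^ Suc ?k * y) * y ^ j"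
      by (simp only: power_Suc[of y] mult.assoc[symmetric] power_add[symmetric]) (simp add: add.commute)
    also have "\<dots> = x ^ j * x ^ ?k * y ^ j" using y(3) by simp
    also have "\<dots> = x ^ ?k * (x ^ j * y ^ j)"
      by (simp only: mult.assoc[symmetric] power_add[symmetric]) (simp add: add.commute)
    finally show ?case using Suc by simp
  qed simp
  note k = this[of ?k]
  \<comment> \<open>One factor \<open>x\<close> fewer than factors \<open>y\<close>, so that
    \<open>x * z\<close> is that idempotent.\<close>
  define z where "z = x ^ m * y ^ ?k"
  have xz: "x * z = x ^ ?k * y ^ ?k" by (simp add: z_def mult.assoc)
  have comm: "x * y ^ i = y ^ i * x" for i
    using power_commuting_commutes[of y x i] y(2) by simp
  show ?thesis
  proof
    show "z \<in> corner e" using assms(2) y(1) unfolding z_def by (intro corner_power_mult corner_power)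
    show "x * z = z * x"
      unfolding z_def by (metis comm mult.assoc power_commutes)
    have "y ^ ?k * x ^ i = x ^ i * y ^ ?k" for i
      by (rule power_commuting_commutes[OF comm, symmetric])
    then have "(x * z) * (x * z) = (x ^ ?k * (x ^ ?k * y ^ ?k)) * y ^ ?k"
      unfolding xz by (metis mult.assoc)
    also have "\<dots> = x * z" unfolding k xz ..
    finally show "(x * z) * (x * z) = x * z" .
    show "x ^ ?k * (x * z) = x ^ ?k" using k xz by simp
  qed
qed

text \<open>Truncated geometric series; the summands carry a factor \<open>f\<close> because the
  term for \<open>i = 0\<close> must be the unit of the corner.\<close>

lemma one_minus_nilp_invertible:
  assumes "idem f" "x \<in> corner f" "nilp x"
  obtains w where "w \<in> corner f" "w * (f - x) = f" "(f - x) * w = f"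
proof -
  obtain k where k: "x ^ k = 0" using assms by (auto simp: nilp_def)
  have f: "f * f = f" using assms by (simp add: idem_def)
  define w where "w j = (\<Sum>i<j. x ^ i * f)" for j
  have wc: "w j \<in> corner f" for j
    unfolding w_def using assms by (intro subspace_sum subspace_corner corner_power_mult idem_corner)
  have xw: "x * w j = w j * x" for j
    unfolding w_def sum_distrib_left sum_distrib_right
    using cornerD[OF assms(2)] by (intro sum.cong refl) (simp add: mult.assoc, metis mult.assoc power_commutes)
  have "w j * (f - x) = f - x ^ j * f" for j
  proof (induction j)
    case (Suc j)
    have "w (Suc j) * (f - x) = w j * (f - x) + x ^ j * (f * (f - x))"
      by (simp add: w_def distrib_right mult.assoc)
    also have "f * (f - x) = f - x * f"
      using cornerD[OF assms(2)] f by (simp add: right_diff_distrib)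
    finally show ?case using Suc by (simp add: right_diff_distrib power_commutes flip: mult.assoc)
  qed (simp add: w_def)
  then have "w k * (f - x) = f" by (simp add: k)
  moreover have "(f - x) * w k = w k * (f - x)"
    using xw cornerD[OF wc] by (simp add: algebra_simps)
  ultimately show ?thesis using that wc by metis
qed

section \<open>The radical of a corner\<close>

lemma radicalI: "x \<in> corner f \<Longrightarrow> (\<And>y. y \<in> corner f \<Longrightarrow> nilp (y * x)) \<Longrightarrow> x \<in> radical f"
  by (simp add: radical_def)

lemma radical_corner: "x \<in> radical f \<Longrightarrow> x \<in> corner f"
  by (simp add: radical_def)

lemma radical_nilp: "idem f \<Longrightarrow> x \<in> radical f \<Longrightarrow> nilp x"
  by (metis (no_types, lifting) cornerD(1) idem_corner mem_Collect_eq radical_def)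

lemma radical_mult_left: "x \<in> radical f \<Longrightarrow> y \<in> corner f \<Longrightarrow> y * x \<in> radical f"
  by (simp add: radical_def corner_mult flip: mult.assoc)

lemma radical_mult_right: "x \<in> radical f \<Longrightarrow> y \<in> corner f \<Longrightarrow> x * y \<in> radical f"
  by (intro radicalI corner_mult) 
    (auto simp: radical_def mult.assoc[symmetric] corner_mult intro: nilp_mult_commute)

text \<open>Let \<open>\<epsilon>\<close> be the Fitting idempotent of
  \<open>s = y * (x + x')\<close>. Then \<open>f - \<epsilon> = f - z * y * x - z * y * x'\<close>
  is left invertible: \<open>w\<close> inverts \<open>f - z * y * x\<close>, and \<open>w'\<close>
  inverts what remains after multiplying by \<open>w\<close>. Since \<open>f - \<epsilon>\<close>
  annihilates \<open>\<epsilon>\<close>, it follows that \<open>\<epsilon> = 0\<close>, that is,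
  \<open>s\<close> is nilpotent.\<close>

lemma radical_add:
  assumes f: "idem f" and x: "x \<in> radical f" and x': "x' \<in> radical f"
  shows "x + x' \<in> radical f"
proof (rule radicalI)
  show "x + x' \<in> corner f" using x x' corner_add radical_corner by blast
  fix y assume y: "y \<in> corner f"
  let ?s = "y * (x + x')"
  have xc: "x \<in> corner f" "x' \<in> corner f" using x x' by (simp_all add: radical_corner)
  have s: "?s \<in> corner f" using xc y by (intro corner_mult corner_add)
  obtain z k where z: "z \<in> corner f" "?s * z = z * ?s" "(?s * z) * (?s * z) = ?s * z"
    "?s ^ k * (?s * z) = ?s ^ k"
    using fitting[OF f s] by blast
  define \<epsilon> where "\<epsilon> = ?s * z"
  have \<epsilon>: "\<epsilon> \<in> corner f" "\<epsilon> * \<epsilon> = \<epsilon>" unfolding \<epsilon>_def using z s corner_mult by auto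
  have "nilp (z * y * x)" using x y z(1) by (simp add: radical_def corner_mult)
  then obtain w where w: "w \<in> corner f" "w * (f - z * y * x) = f"
    using one_minus_nilp_invertible[OF f] xc y z(1) corner_mult by metis
  have "w * z * y \<in> corner f" using w y z(1) by (intro corner_mult)
  then have "nilp (w * z * y * x')" using x' by (simp add: radical_def)
  then obtain w' where w': "w' \<in> corner f" "w' * (f - w * z * y * x') = f"
    using one_minus_nilp_invertible[OF f, of "w * z * y * x'"] xc w(1) y z(1) corner_mult by metis
  have "w * (f - \<epsilon>) = w * (f - z * y * x) - w * z * y * x'"
    unfolding \<epsilon>_def z(2) by (simp add: algebra_simps)
  then have "w' * (w * (f - \<epsilon>)) = f" using w(2) w'(2) by simp
  moreover have "(f - \<epsilon>) * \<epsilon> = 0" using \<epsilon> by (simp add: algebra_simps cornerD)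
  ultimately have "f * \<epsilon> = 0" by (metis mult.assoc mult_zero_right)
  then have "\<epsilon> = 0" using \<epsilon> cornerD by simp
  then show "nilp ?s" using z(4) unfolding \<epsilon>_def nilp_def by (metis mult_zero_right)
qed

lemma subspace_radical:
  assumes "idem f" shows "subspace (radical f)"
proof (rule subspaceI)
  show "0 \<in> radical f" by (intro radicalI corner_0) (auto simp: nilp_def intro: exI[of _ 1])
  show "c *\<^sub>K x \<in> radical f" if x: "x \<in> radical f" for c x
  proof (rule radicalI)
    show "c *\<^sub>K x \<in> corner f" using x by (intro corner_scale radical_corner)
    fix y assume y: "y \<in> corner f"
    have "y * (c *\<^sub>K x) = (c *\<^sub>K y) * x" by (simp only: scale_mult_left scale_mult_right)
    then show "nilp (y * (c *\<^sub>K x))" using x corner_scale[OF y] by (simp add: radical_def)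
  qed
qed (use assms radical_add in auto)

lemma radical_power_diff:
  assumes f: "idem f" and "x \<in> corner f" "y \<in> corner f" "x - y \<in> radical f"
  shows "x ^ k - y ^ k \<in> radical f"
proof (induction k)
  case 0 show ?case using subspace_radical[OF f] by (simp add: subspace_0)
next
  case (Suc k)
  show ?case
  \<comment> \<open>Only for positive exponents is \<open>y ^ k\<close> guaranteed to lie in the
    corner.\<close>
  proof (cases k)
    case (Suc j)
    have "x ^ Suc k - y ^ Suc k = x * (x ^ k - y ^ k) + (x - y) * y ^ k"
      by (simp add: algebra_simps)
    also have "\<dots> \<in> radical f"
      using Suc.IH assms corner_power[OF assms(3), of j]
      by (intro radical_add[OF f] radical_mult_left radical_mult_right) (simp_all add: Suc)
    finally show ?thesis .
  qed (use assms in simp)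
qed

lemma nilp_mod_radical:
  assumes f: "idem f" and "x \<in> corner f" "y \<in> corner f" "x - y \<in> radical f" "nilp y"
  shows "nilp x"
proof -
  obtain k where "y ^ k = 0" using assms by (auto simp: nilp_def)
  then have "nilp (x ^ k)" using radical_power_diff[OF assms(1-4), of k] radical_nilp[OF f] by simp
  then show ?thesis unfolding nilp_def by (metis power_mult)
qed

section \<open>Local idempotents and completion of columns to units\<close>

definition local_idem :: "'a \<Rightarrow> bool" where
  "local_idem e \<longleftrightarrow> idem e \<and> e \<noteq> 0 \<and>
     (\<forall>x \<in> corner e. nilp x \<or> (\<exists>z \<in> corner e. x * z = e \<and> z * x = e))"

text \<open>A nonzero idempotent with smallest corner is local: the Fitting idempotent of
  \<open>x\<close> is either 0, so that \<open>x\<close> is nilpotent, or has the same corner and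
  therefore equals \<open>e\<close>, so that \<open>x\<close> is a unit.\<close>

lemma local_idem_exists:
  assumes "idem f" "f \<noteq> 0"
  obtains e where "local_idem e" "e \<in> corner f"
proof -
  let ?P = "\<lambda>e. idem e \<and> e \<noteq> 0 \<and> e \<in> corner f"
  have "?P f" using assms idem_corner by blast
  then obtain e where e: "?P e" and min: "\<And>e'. ?P e' \<Longrightarrow> dim (corner e) \<le> dim (corner e')"
    using ex_has_least_nat[of ?P f "\<lambda>e. dim (corner e)"] by blast
  have "nilp x \<or> (\<exists>z \<in> corner e. x * z = e \<and> z * x = e)" if x: "x \<in> corner e" for x
  proof -
    obtain z k where z: "z \<in> corner e" "x * z = z * x" "(x * z) * (x * z) = x * z"
      "x ^ k * (x * z) = x ^ k"
      using fitting[of e x] e x by blast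
    have c: "x * z \<in> corner e" using x z(1) by (rule corner_mult)
    then have i: "idem (x * z)" using z(3) by (simp add: idem_def cornerD)
    show ?thesis
    proof (cases "x * z = 0")
      case True
      then show ?thesis using z(4) unfolding nilp_def by (metis mult_zero_right)
    next
      case False
      then have "?P (x * z)" using c i e corner_mono by blast
      then have "\<not> dim (corner (x * z)) < dim (corner e)" using min leD by blast
      then have "corner (x * z) = corner e"
        using dim_strict_mono[OF subspace_corner, of "x * z" "corner e"] corner_mono[OF i c] cornerD(3)
        by blast
      then have "e \<in> corner (x * z)" using e idem_corner by blast
      then have "x * z = e" using c by (metis cornerD(1) cornerD(2))
      then show ?thesis using z by auto
    qed
  qed
  then show ?thesis using that[of e] e by (auto simp: local_idem_def)
qed

lemma not_nilp_of_left_inverse: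
  assumes "e \<noteq> 0" "a * b = e" "e * b = b"
  shows "\<not> nilp b"
proof
  assume "nilp b"
  then obtain k where "b ^ k = 0" by (auto simp: nilp_def)
  then have "b ^ Suc k = 0" by simp
  then show False using left_inverse_power[OF assms(2,3), of "Suc k"] assms(1) by simp
qed

definition mutual_inverse :: "'a \<Rightarrow> 'a \<Rightarrow> 'a \<Rightarrow> bool" where
  "mutual_inverse f g h \<longleftrightarrow> g \<in> corner f \<and> h \<in> corner f \<and> g * h = f \<and> h * g = f"

lemma mutual_inverse_mult:
  assumes "mutual_inverse f g h" "mutual_inverse f g' h'"
  shows "mutual_inverse f (g * g') (h' * h)"
proof -
  have "(g * g') * (h' * h) = g * (g' * h') * h" "(h' * h) * (g * g') = h' * (h * g) * g'"
    by (simp_all only: mult.assoc)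
  then show ?thesis using assms by (auto simp: mutual_inverse_def corner_mult cornerD)
qed

text \<open>The pivot case: \<open>u\<close> completes to the unit \<open>u + (f - e)\<close> once its \<open>e\<close>-entry is invertible.\<close>

lemma complete_unit_pivot:
  assumes f: "idem f" and e: "idem e" "e \<in> corner f"
    and u: "u \<in> corner f" "u * e = u"
    and z: "z \<in> corner e" "z * (e * u) = e" "e * u * z = e"
  obtains g h where "mutual_inverse f g h" "g * e = u"
proof -
  define f' where "f' = f - e"
  have i: "idem f'" and f'c: "f' \<in> corner f" using idem_diff[OF e(1) f e(2)] by (simp_all add: f'_def)
  have ff: "f * f = f" "f * e = e" "e * f = e" "e * e = e" "f' * f' = f'"
    using f e i by (auto simp: idem_def corner_def)
  have z': "z * e = z" "e * z = z" "z * f = z" "f * z = z" and zf: "z \<in> corner f"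
    using z(1) corner_mono[OF e] by (auto simp: corner_def)
  have u': "f * u = u" "u * f = u" using u cornerD by auto
  have "u * f' = 0" using u u' by (simp add: f'_def algebra_simps)
  have zu: "z * u = e" using z(2) z'(1) by (simp flip: mult.assoc)
  have uz: "u * z = e + f' * (u * z)"
    using z(3) u' by (simp add: f'_def algebra_simps) (metis mult.assoc)
  \<comment> \<open>In blocks for \<open>f = e + f'\<close>, \<open>g\<close> is lower triangular
    with first column \<open>u\<close> and second diagonal entry \<open>f'\<close>; \<open>h\<close>
    is the inverse triangular matrix, with entries \<open>z\<close>, \<open>- f' * u * z\<close> and
    \<open>f'\<close>.\<close>
  define g h where "g = u + f'" and "h = z - f' * u * z + f'"
  have zero: "f' * z = 0" "z * f' = 0" "f' * e = 0" "e * f' = 0"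
    using z' ff by (simp_all add: f'_def algebra_simps)
  have "g * h = f"
  proof -
    have "g * h = u * z - (u * f') * u * z + u * f' + f' * z - f' * f' * u * z + f' * f'"
      by (simp add: g_def h_def algebra_simps)
    also have "\<dots> = (e + f' * (u * z)) - f' * (u * z) + f'"
      using \<open>u * f' = 0\<close> zero ff uz by (simp add: mult.assoc)
    finally show ?thesis by (simp add: f'_def)
  qed
  moreover have "h * g = f"
  proof -
    have "h * g = z * u + z * f' - f' * u * (z * u) - f' * u * (z * f') + f' * u + f' * f'"
      by (simp add: g_def h_def algebra_simps)
    also have "\<dots> = e - f' * (u * e) + f' * u + f'"
      by (simp add: zu zero ff mult.assoc)
    finally show ?thesis using u by (simp add: f'_def)
  qed
  moreover have "g \<in> corner f" "h \<in> corner f"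
    unfolding g_def h_def using u f'c zf by (intro corner_add corner_diff corner_mult; simp)+
  moreover have "g * e = u" using u zero by (simp add: g_def algebra_simps)
  ultimately show ?thesis using that by (simp add: mutual_inverse_def)
qed

text \<open>A form of cancellation for the local summand \<open>e\<close>: if the \<open>e\<close>-entry of \<open>u\<close> is nilpotent, a
  transvection makes it invertible.\<close>

lemma complete_unit:
  assumes f: "idem f" and e: "local_idem e" "e \<in> corner f"
    and u: "u \<in> corner f" "u * e = u" and w: "w \<in> corner f" "e * w = w" "w * u = e"
  obtains g h where "mutual_inverse f g h" "g * e = u"
proof -
  have ie: "idem e" and ec: "e \<in> corner e" and e0: "e \<noteq> 0"
    using e idem_corner by (auto simp: local_idem_def)
  have ee: "e * e = e" "f * e = e" "e * f = e" using ie cornerD[OF e(2)] by (auto simp: idem_def)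
  have u': "f * u = u" "u * f = u" using u cornerD by auto
  have w': "f * w = w" "w * f = w" using w cornerD by auto
  have eu: "e * u \<in> corner e"
    using corner_conj[OF ie cornerD(3)[OF u(1)]] u(2) by (simp add: mult.assoc)
  have unit: "\<exists>z \<in> corner e. x * z = e \<and> z * x = e" if "x \<in> corner e" "\<not> nilp x" for x
    using e(1) that by (auto simp: local_idem_def)
  show ?thesis
  proof (cases "nilp (e * u)")
    case False
    then obtain z where "z \<in> corner e" "z * (e * u) = e" "e * u * z = e" using unit[OF eu] by auto
    then show ?thesis using complete_unit_pivot[OF f ie e(2) u] that by blast
  next
    case True
    \<comment> \<open>The part of \<open>w * u = e\<close> that passes through the
      \<open>e\<close>-entry of \<open>u\<close>. As that entry is nilpotent, \<open>s\<close> is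
      not a unit, so by locality it is nilpotent and the other part
      \<open>e - s = w * (f - e) * u\<close> is a unit.\<close>
    define s where "s = w * e * u"
    have we: "w * e \<in> corner e"
      using corner_conj[OF ie cornerD(3)[OF w(1)]] w(2) by simp
    have s: "s \<in> corner e" using corner_mult[OF we eu] ee by (simp add: s_def mult.assoc) (metis ee(1) mult.assoc)
    have "nilp s"
    proof (rule ccontr)
      assume "\<not> nilp s"
      then obtain z where z: "z \<in> corner e" "z * s = e" using unit[OF s] by auto
      then have "(z * w) * (e * u) = e" by (simp add: s_def mult.assoc)
      then show False using not_nilp_of_left_inverse[OF e0, of "z * w" "e * u"] ee(1) True
        by (simp flip: mult.assoc)
    qed
    then obtain z where z: "z \<in> corner e" "z * (e - s) = e"
      using one_minus_nilp_invertible[OF ie s] by blast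
    have zc: "z \<in> corner f" "z * e = z" using z corner_mono[OF ie e(2)] cornerD by auto
    \<comment> \<open>A row with \<open>p * u = e\<close> and \<open>p * p = 0\<close>. The
      transvection \<open>f + p\<close> turns \<open>u\<close> into \<open>u + e\<close>, whose
      \<open>e\<close>-entry \<open>e + e * u\<close> is a unit because \<open>e * u\<close> is
      nilpotent.\<close>
    define p where "p = z * w * (f - e)"
    have pc: "p \<in> corner f" unfolding p_def using zc w e f idem_corner
      by (intro corner_mult corner_diff; simp)
    have "w * (f - e) * u = e - s" using w' u' w by (simp add: s_def algebra_simps)
    then have pu: "p * u = e" using z(2) by (simp add: p_def mult.assoc)
    have ep: "e * p = p" using zc cornerD(1)[OF z(1)] by (simp add: p_def flip: mult.assoc)
    have pe: "p * e = 0" using ee by (simp add: p_def mult.assoc left_diff_distrib)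
    have pp: "p * p = 0" using ep pe by (metis mult.assoc mult_zero_left)
    have "f * p = p" "p * f = p" "f * f = f" using cornerD[OF pc] f by (simp_all add: idem_def)
    then have "(f - p) * (f + p) = f" "(f + p) * (f - p) = f"
      using pp by (simp_all add: distrib_left distrib_right left_diff_distrib right_diff_distrib)
    then have T: "mutual_inverse f (f - p) (f + p)"
      using pc idem_corner[OF f] by (simp add: mutual_inverse_def corner_add corner_diff)
    define v where "v = (f + p) * u"
    have v: "v = u + e" using pu u' by (simp add: v_def algebra_simps)
    have "v \<in> corner f" "v * e = v" using v u e corner_add ee by (auto simp: algebra_simps)
    moreover obtain y where "y \<in> corner e" "y * (e * v) = e" "e * v * y = e"
    proof -
      have "nilp (- (e * u))" using True by (rule nilp_uminus)
      then obtain y where "y \<in> corner e" "y * (e - - (e * u)) = e" "(e - - (e * u)) * y = e"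
        using one_minus_nilp_invertible[OF ie corner_neg[OF eu]] by blast
      then show ?thesis using that[of y] ee by (simp add: v algebra_simps)
    qed
    ultimately obtain g h where gh: "mutual_inverse f g h" "g * e = v"
      using complete_unit_pivot[OF f ie e(2)] by metis
    have "(f - p) * v = u"
      using T u' unfolding v_def mutual_inverse_def by (metis mult.assoc)
    then have "((f - p) * g) * e = u" using gh(2) by (simp add: mult.assoc)
    then show ?thesis using that mutual_inverse_mult[OF T gh(1)] by blast
  qed
qed

text \<open>With \<open>u = g * e\<close> for the last column \<open>u = a ^ l * e\<close> outside
  the radical, \<open>h * a * g * e = h * (a ^ Suc l * e)\<close> lies in the radical.\<close>

lemma conj_kills_local_idem:
  assumes f: "idem f" and e: "local_idem e" "e \<in> corner f" and a: "a \<in> corner f" "nilp a"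
  obtains g h where "mutual_inverse f g h" "h * a * g * e \<in> radical f"
proof -
  have ie: "idem e" and e0: "e \<noteq> 0" and ee: "e * e = e"
    using e by (auto simp: local_idem_def idem_def)
  have ap: "a ^ k * e \<in> corner f" for k using a(1) e(2) by (rule corner_power_mult)
  obtain k where "a ^ k = 0" using a by (auto simp: nilp_def)
  then have ex: "a ^ k * e \<in> radical f" using subspace_radical[OF f] by (simp add: subspace_0)
  define m where "m = (LEAST k. a ^ k * e \<in> radical f)"
  have m: "a ^ m * e \<in> radical f" unfolding m_def using ex by (rule LeastI)
  have "m \<noteq> 0"
  proof
    assume "m = 0"
    then have "nilp e" using m radical_nilp[OF f] by simp
    then show False using not_nilp_of_left_inverse[of e e e] ee e0 by simp
  qed
  then obtain l where l: "m = Suc l" using not0_implies_Suc by blast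
  define u where "u = a ^ l * e"
  have u: "u \<in> corner f" "u * e = u" using ap ee by (auto simp: u_def mult.assoc)
  have "u \<notin> radical f" using not_less_Least[of l "\<lambda>k. a ^ k * e \<in> radical f"] l unfolding u_def m_def by simp
  then obtain y where y: "y \<in> corner f" "\<not> nilp (y * u)" using u by (auto simp: radical_def)
  \<comment> \<open>Since \<open>u = u * e\<close>, rotating the last \<open>e\<close> to the front
    preserves nilpotency and brings \<open>y * u\<close> into the corner of \<open>e\<close>, where
    locality applies.\<close>
  have "\<not> nilp (e * y * u)"
    using y(2) nilp_mult_commute[of e "y * u"] u(2) by (auto simp: mult.assoc)
  moreover have "e * y * u \<in> corner e"
    using corner_conj[OF ie, of "y * u"] y u mult_E cornerD(3) by (simp add: mult.assoc)
  ultimately obtain z where z: "z \<in> corner e" "z * (e * y * u) = e"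
    using e(1) by (auto simp: local_idem_def)
  define w where "w = z * e * y"
  have "z \<in> corner f" using z(1) corner_mono[OF ie e(2)] by auto
  then have "w \<in> corner f" unfolding w_def using e(2) y(1) by (intro corner_mult)
  moreover have "e * w = w" using cornerD[OF z(1)] by (simp add: w_def flip: mult.assoc)
  moreover have "w * u = e" using z(2) by (simp add: w_def mult.assoc)
  ultimately obtain g h where gh: "mutual_inverse f g h" "g * e = u"
    using complete_unit[OF f e u] by blast
  have "h * a * g * e = h * (a ^ m * e)" using gh(2) by (simp add: u_def l mult.assoc)
  also have "\<dots> \<in> radical f" using m gh(1) by (auto simp: mutual_inverse_def intro: radical_mult_left)
  finally show ?thesis using that gh(1) by blast
qed

theorem nilpotents_conj_into_subspace:
  assumes "idem f"
  shows "\<exists>U. subspace U \<and> U \<subseteq> corner f \<and> (\<forall>x\<in>U. nilp x) \<and>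
    (\<forall>a \<in> corner f. nilp a \<longrightarrow> (\<exists>g h. mutual_inverse f g h \<and> h * a * g \<in> U))"
  using assms
proof (induction "dim (corner f)" arbitrary: f rule: less_induct)
  case less
  note f = less.prems
  show ?case
  proof (cases "f = 0")
    case True
    have "mutual_inverse 0 0 0" using corner_0 by (simp add: mutual_inverse_def)
    moreover have "nilp 0" unfolding nilp_def by (rule exI[of _ 1]) simp
    ultimately show ?thesis
      unfolding True by (intro exI[of _ "{0}"]) (auto simp: subspace_0 corner_0 intro!: exI[of _ 0])
  next
    case False
    then obtain e where e: "local_idem e" "e \<in> corner f" using local_idem_exists f by blast
    have ie: "idem e" and e0: "e \<noteq> 0" using e by (auto simp: local_idem_def)
    define f' where "f' = f - e"
    have f': "idem f'" "f' \<in> corner f" using idem_diff[OF ie f e(2)] by (simp_all add: f'_def)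
    have ef: "e * f' = 0" "f' * e = 0" "e * e = e" "f = e + f'"
      using cornerD[OF e(2)] ie by (auto simp: f'_def algebra_simps idem_def)
    have sub: "corner f' \<subseteq> corner f" using corner_mono[OF f'] .
    \<comment> \<open>The witness that the corner shrinks strictly, so that the induction hypothesis
      applies.\<close>
    have "e \<notin> corner f'" using cornerD(1)[of e f'] ef e0 by auto
    then have "corner f' \<subset> corner f" using sub e(2) by blast
    then have "dim (corner f') < dim (corner f)"
      using dim_strict_mono[OF subspace_corner] cornerD(3) by blast
    then obtain U' where U': "subspace U'" "U' \<subseteq> corner f'" "\<And>x. x \<in> U' \<Longrightarrow> nilp x"
      and conj': "\<And>a. a \<in> corner f' \<Longrightarrow> nilp a \<Longrightarrow> \<exists>g h. mutual_inverse f' g h \<and> h * a * g \<in> U'"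
      using less.hyps[OF _ f'(1)] by blast
    \<comment> \<open>In blocks for \<open>f = e + f'\<close>: the \<open>e\<close>-column is
      radical, the \<open>f'\<close>-diagonal block lies in \<open>U'\<close>, and
      \<open>e * x * f'\<close> is free.\<close>
    define U where "U = {x \<in> corner f. x * e \<in> radical f \<and> f' * x * f' \<in> U'}"
    have diff: "x - x * f' = x * e" if "x \<in> corner f" for x
      using cornerD(2)[OF that] by (simp add: f'_def algebra_simps)
    \<comment> \<open>Modulo the radical \<open>x\<close> equals \<open>x * f'\<close>, and rotating
      a factor \<open>f'\<close> turns this into the diagonal block.\<close>
    have nilp_iff: "nilp x \<longleftrightarrow> nilp (f' * x * f')" if x: "x \<in> corner f" "x * e \<in> radical f" for x
    proof -
      have xf: "x * f' \<in> corner f" using x f' corner_mult by blast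
      have "x * f' - x \<in> radical f"
        using diff[OF x(1)] x(2) subspace_neg[OF subspace_radical[OF f], of "x * e"] by (metis minus_diff_eq)
      then have "nilp x \<longleftrightarrow> nilp (x * f')"
        using nilp_mod_radical[OF f] diff[OF x(1)] x xf by metis
      also have "\<dots> \<longleftrightarrow> nilp (f' * (x * f'))"
        using nilp_mult_commute[of "x * f'" f'] nilp_mult_commute[of f' "x * f'"] f'(1)
        by (auto simp: idem_def mult.assoc)
      finally show ?thesis by (simp add: mult.assoc)
    qed
    have "subspace U"
      using subspace_corner[of f] subspace_radical[OF f] U'(1) unfolding U_def subspace_def
      by (simp add: distrib_left distrib_right scale_mult_left scale_mult_right)
    moreover have "nilp x" if "x \<in> U" for x
      using that U'(3) nilp_iff by (auto simp: U_def)
    moreover have "\<exists>g h. mutual_inverse f g h \<and> h * a * g \<in> U" if a: "a \<in> corner f" "nilp a" for a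
    proof -
      obtain g h where gh: "mutual_inverse f g h" "h * a * g * e \<in> radical f"
        using conj_kills_local_idem[OF f e a] by blast
      define b where "b = h * a * g"
      have ghc: "g \<in> corner f" "h \<in> corner f" "g * h = f" using gh by (auto simp: mutual_inverse_def)
      have b: "b \<in> corner f" "b * e \<in> radical f"
        using gh(2) a ghc by (auto simp: b_def intro!: corner_mult)
      have "nilp (g * (h * a))" using ghc a cornerD by (simp flip: mult.assoc)
      then have "nilp b" unfolding b_def by (rule nilp_mult_commute)
      then have "nilp (f' * b * f')" using nilp_iff[OF b] by simp
      then obtain g' h' where gh': "mutual_inverse f' g' h'" "h' * (f' * b * f') * g' \<in> U'"
        using conj'[OF corner_conj[OF f'(1)]] cornerD(3)[OF b(1)] by blast
      have c': "g' \<in> corner f'" "h' \<in> corner f'" using gh' by (auto simp: mutual_inverse_def)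
      have z: "g' * e = 0" "e * g' = 0" "h' * e = 0" "e * h' = 0"
        using c' ef by (metis cornerD mult.assoc mult_zero_left mult_zero_right)+
      have cf: "g' \<in> corner f" "h' \<in> corner f" using c' sub by auto
      \<comment> \<open>A block-diagonal unit: it fixes \<open>e\<close> on the right, so the
        \<open>e\<close>-column stays radical, and it conjugates the \<open>f'\<close>-block by
        \<open>g'\<close>.\<close>
      have inv: "mutual_inverse f (e + g') (e + h')"
        using gh'(1) z ef cf e(2) by (auto simp: mutual_inverse_def distrib_left distrib_right corner_add)
      have "(e + h') * b * (e + g') \<in> U"
      proof -
        have "(e + h') * b * (e + g') * e = (e + h') * (b * e)"
          using z ef by (simp add: mult.assoc distrib_right)
        then have "(e + h') * b * (e + g') * e \<in> radical f"
          using b cf e(2) by (simp add: radical_mult_left corner_add)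
        moreover have "f' * ((e + h') * b * (e + g')) * f' = h' * (f' * b * f') * g'"
        proof -
          have "f' * (e + h') = h' * f'" "(e + g') * f' = f' * g'"
            using ef c' by (simp_all add: distrib_left distrib_right cornerD)
          then have "f' * ((e + h') * b * (e + g')) * f' = (h' * f') * b * (f' * g')"
            by (simp only: mult.assoc[symmetric]) (simp only: mult.assoc)
          then show ?thesis by (simp only: mult.assoc)
        qed
        moreover have "(e + h') * b * (e + g') \<in> corner f"
          using b cf e(2) by (intro corner_mult corner_add)
        ultimately show ?thesis using gh'(2) by (simp add: U_def)
      qed
      moreover have "(e + h') * b * (e + g') = ((e + h') * h) * a * (g * (e + g'))"
        by (simp add: b_def mult.assoc)
      ultimately show ?thesis using mutual_inverse_mult[OF gh(1) inv] by metis
    qed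
    moreover have "U \<subseteq> corner f" by (auto simp: U_def)
    ultimately show ?thesis by blast
  qed
qed

end

section \<open>The endomorphism algebra of a representation\<close>

text \<open>The locale needs a type of class \<open>ring_1\<close>, and square matrices carry their
  size as a value. One index set \<open>nat \<times> nat\<close> accommodates the direct sums for
  all dimension vectors.\<close>

typedef (overloaded) 'k linop =
  "{f :: (nat \<times> nat \<Rightarrow> 'k::field) \<Rightarrow> nat \<times> nat \<Rightarrow> 'k.
     (\<forall>v w. f (\<lambda>i. v i + w i) = (\<lambda>i. f v i + f w i)) \<and> (\<forall>c v. f (\<lambda>i. c * v i) = (\<lambda>i. c * f v i))}"
  morphisms apply_op Abs_op
  by (rule exI[of _ "\<lambda>v. v"]) simp

setup_lifting type_definition_linop

lemma op_eqI: "(\<And>v i. apply_op f v i = apply_op g v i) \<Longrightarrow> f = g"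
  by (simp add: apply_op_inject[symmetric] ext)

lemma apply_op_add: "apply_op f (\<lambda>i. v i + w i) = (\<lambda>i. apply_op f v i + apply_op f w i)"
  using apply_op[of f] by blast

lemma apply_op_cmult: "apply_op f (\<lambda>i. c * v i) = (\<lambda>i. c * apply_op f v i)"
  using apply_op[of f] by blast

instantiation linop :: (field) ring_1
begin

lift_definition zero_linop :: "'a linop" is "\<lambda>v i. 0" by simp
lift_definition one_linop :: "'a linop" is "\<lambda>v. v" by simp
lift_definition plus_linop :: "'a linop \<Rightarrow> 'a linop \<Rightarrow> 'a linop" is "\<lambda>f g v i. f v i + g v i"
  by (auto simp: algebra_simps)
lift_definition uminus_linop :: "'a linop \<Rightarrow> 'a linop" is "\<lambda>f v i. - f v i"
  by (auto simp: algebra_simps)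
lift_definition minus_linop :: "'a linop \<Rightarrow> 'a linop \<Rightarrow> 'a linop" is "\<lambda>f g v i. f v i - g v i"
  by (auto simp: algebra_simps)
lift_definition times_linop :: "'a linop \<Rightarrow> 'a linop \<Rightarrow> 'a linop" is "\<lambda>f g v. f (g v)"
  by auto

instance
proof
  fix a b c :: "'a linop"
  show "(0 :: 'a linop) \<noteq> 1"
  proof
    assume "(0 :: 'a linop) = 1"
    then have "apply_op 0 (\<lambda>_. 1) (0, 0) = apply_op 1 (\<lambda>_. 1 :: 'a) (0, 0)" by simp
    then show False by (simp add: zero_linop.rep_eq one_linop.rep_eq)
  qed
qed (rule op_eqI; simp add: zero_linop.rep_eq one_linop.rep_eq plus_linop.rep_eq uminus_linop.rep_eq
    minus_linop.rep_eq times_linop.rep_eq apply_op_add add.assoc add.commute)+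

end

lift_definition scale_op :: "'k::field \<Rightarrow> 'k linop \<Rightarrow> 'k linop" is "\<lambda>c f v i. c * f v i"
  by (auto simp: algebra_simps)

lemmas op_rep_eqs = zero_linop.rep_eq one_linop.rep_eq plus_linop.rep_eq times_linop.rep_eq scale_op.rep_eq

lemma apply_op_sum: "apply_op (sum f A) v i = (\<Sum>a\<in>A. apply_op (f a) v i)"
  by (induction A rule: infinite_finite_induct) (simp_all add: op_rep_eqs)

interpretation linop: vector_space scale_op
  by unfold_locales (rule op_eqI; simp add: op_rep_eqs algebra_simps)+

section \<open>Matrix tuples as operators\<close>

definition mat_tuples :: "nat \<Rightarrow> (nat \<Rightarrow> nat) \<Rightarrow> (nat \<Rightarrow> 'k::field mat) set" where
  "mat_tuples n d = {N. (\<forall>i<n. N i \<in> carrier_mat (d i) (d i)) \<and> (\<forall>i\<ge>n. N i = 0\<^sub>m 0 0)}"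

text \<open>A tuple acts on the direct sum of the \<open>k ^ d i\<close>; coordinate \<open>r\<close> of the \<open>i\<close>-th summand is \<open>(i, r)\<close>.\<close>

lift_definition tuple_op :: "nat \<Rightarrow> (nat \<Rightarrow> nat) \<Rightarrow> (nat \<Rightarrow> 'k::field mat) \<Rightarrow> 'k linop" is
  "\<lambda>n d N v (i, r). if i < n \<and> r < d i then \<Sum>c<d i. N i $$ (r, c) * v (i, c) else 0"
  by (auto simp: fun_eq_iff distrib_left sum.distrib sum_distrib_left mult.left_commute)

lift_definition unit_op :: "nat \<Rightarrow> nat \<Rightarrow> nat \<Rightarrow> 'k::field linop" is
  "\<lambda>i r c v p. if p = (i, r) then v (i, c) else 0"
  by (auto simp: fun_eq_iff)

lemma tuple_op_add:
  assumes "N \<in> mat_tuples n d" "M \<in> mat_tuples n d"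
  shows "tuple_op n d (\<lambda>i. N i + M i) = tuple_op n d N + tuple_op n d M"
proof (rule op_eqI)
  fix v :: "nat \<times> nat \<Rightarrow> 'a" and p :: "nat \<times> nat"
  obtain i r where p: "p = (i, r)" by force
  have "i < n \<Longrightarrow> N i \<in> carrier_mat (d i) (d i)" "i < n \<Longrightarrow> M i \<in> carrier_mat (d i) (d i)"
    using assms by (auto simp: mat_tuples_def)
  then show "apply_op (tuple_op n d (\<lambda>i. N i + M i)) v p = apply_op (tuple_op n d N + tuple_op n d M) v p"
    by (auto simp: p tuple_op.rep_eq op_rep_eqs distrib_right sum.distrib)
qed

lemma tuple_op_scale:
  assumes "N \<in> mat_tuples n d"
  shows "tuple_op n d (\<lambda>i. c \<cdot>\<^sub>m N i) = scale_op c (tuple_op n d N)"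
proof (rule op_eqI)
  fix v :: "nat \<times> nat \<Rightarrow> 'a" and p :: "nat \<times> nat"
  obtain i r where p: "p = (i, r)" by force
  have "i < n \<Longrightarrow> N i \<in> carrier_mat (d i) (d i)"
    using assms by (auto simp: mat_tuples_def)
  then show "apply_op (tuple_op n d (\<lambda>i. c \<cdot>\<^sub>m N i)) v p = apply_op (scale_op c (tuple_op n d N)) v p"
    by (auto simp: p tuple_op.rep_eq op_rep_eqs sum_distrib_left mult.assoc)
qed

lemma tuple_op_mult:
  assumes "N \<in> mat_tuples n d" "M \<in> mat_tuples n d"
  shows "tuple_op n d (\<lambda>i. N i * M i) = tuple_op n d N * tuple_op n d M"
proof (rule op_eqI)
  fix v :: "nat \<times> nat \<Rightarrow> 'a" and p :: "nat \<times> nat"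
  obtain i r where p: "p = (i, r)" by force
  show "apply_op (tuple_op n d (\<lambda>i. N i * M i)) v p = apply_op (tuple_op n d N * tuple_op n d M) v p"
  proof (cases "i < n \<and> r < d i")
    case True
    then have c: "N i \<in> carrier_mat (d i) (d i)" "M i \<in> carrier_mat (d i) (d i)"
      using assms by (auto simp: mat_tuples_def)
    have "(\<Sum>c<d i. (N i * M i) $$ (r, c) * v (i, c))
        = (\<Sum>c<d i. \<Sum>l<d i. N i $$ (r, l) * M i $$ (l, c) * v (i, c))"
      using True c by (intro sum.cong) (auto simp: scalar_prod_def sum_distrib_right atLeast0LessThan)
    also have "\<dots> = (\<Sum>l<d i. \<Sum>c<d i. N i $$ (r, l) * M i $$ (l, c) * v (i, c))"
      by (rule sum.swap)
    also have "\<dots> = (\<Sum>l<d i. N i $$ (r, l) * (\<Sum>c<d i. M i $$ (l, c) * v (i, c)))"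
      by (simp add: sum_distrib_left mult.assoc)
    finally show ?thesis using True by (simp add: p tuple_op.rep_eq op_rep_eqs)
  qed (auto simp: p tuple_op.rep_eq op_rep_eqs)
qed

lemma tuple_op_entry:
  assumes "i < n" "r < d i" "c < d i"
  shows "apply_op (tuple_op n d N) (\<lambda>p. if p = (i, c) then 1 else 0) (i, r) = N i $$ (r, c)"
  using assms by (simp add: tuple_op.rep_eq if_distrib[of "\<lambda>x. _ * x"] cong: if_cong)

lemma tuple_op_inj:
  assumes "N \<in> mat_tuples n d" "M \<in> mat_tuples n d" "tuple_op n d N = tuple_op n d M"
  shows "N = M"
proof
  fix i
  show "N i = M i"
  proof (cases "i < n")
    case True
    then have "N i \<in> carrier_mat (d i) (d i)" "M i \<in> carrier_mat (d i) (d i)"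
      using assms by (auto simp: mat_tuples_def)
    moreover have "N i $$ (r, c) = M i $$ (r, c)" if "r < d i" "c < d i" for r c
      using tuple_op_entry[where d = d, OF True that] assms(3) by metis
    ultimately show ?thesis by (intro eq_matI) auto
  qed (use assms in \<open>auto simp: mat_tuples_def\<close>)
qed

lemma tuple_op_in_span:
  "tuple_op n d N \<in> linop.span ((\<lambda>(i, r, c). unit_op i r c) ` (SIGMA i:{..<n}. {..<d i} \<times> {..<d i}))"
proof -
  have "tuple_op n d N = (\<Sum>(i, r, c)\<in>(SIGMA i:{..<n}. {..<d i} \<times> {..<d i}). scale_op (N i $$ (r, c)) (unit_op i r c))"
    (is "_ = sum ?f ?A")
  proof (rule op_eqI)
    fix v :: "nat \<times> nat \<Rightarrow> 'a" and p :: "nat \<times> nat"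
    obtain j s where p: "p = (j, s)" by force
    have "apply_op (sum ?f ?A) v p = (\<Sum>(i, r, c)\<in>?A. if i = j \<and> r = s then N i $$ (r, c) * v (i, c) else 0)"
      unfolding apply_op_sum by (intro sum.cong) (auto simp: p op_rep_eqs unit_op.rep_eq)
    also have "\<dots> = (\<Sum>(i, r, c)\<in>?A \<inter> {(i, r, c). i = j \<and> r = s}. N i $$ (r, c) * v (i, c))"
      by (intro sum.mono_neutral_cong_right) (auto intro: finite_SigmaI split: if_splits)
    also have "\<dots> = (\<Sum>c\<in>(if j < n \<and> s < d j then {..<d j} else {}). N j $$ (s, c) * v (j, c))"
      by (intro sum.reindex_bij_witness[of _ "\<lambda>c. (j, s, c)" "\<lambda>(i, r, c). c"]) (auto split: if_splits)
    also have "\<dots> = apply_op (tuple_op n d N) v p" by (simp add: p tuple_op.rep_eq)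
    finally show "apply_op (tuple_op n d N) v p = apply_op (sum ?f ?A) v p" ..
  qed
  also have "\<dots> \<in> linop.span ((\<lambda>(i, r, c). unit_op i r c) ` ?A)"
    by (intro linop.span_sum) (auto intro!: linop.span_scale intro: linop.span_base simp: image_iff split_beta)
  finally show ?thesis .
qed

lemma mat_tuples_mult: "N \<in> mat_tuples n d \<Longrightarrow> M \<in> mat_tuples n d \<Longrightarrow> (\<lambda>i. N i * M i) \<in> mat_tuples n d"
  by (auto simp: mat_tuples_def)

text \<open>Positive exponents again: the ambient \<open>1\<close> also fixes the coordinates
  outside the direct sum, where every tuple acts as zero.\<close>

lemma tuple_op_power:
  assumes N: "N \<in> mat_tuples n d"
  shows "(\<lambda>i. N i ^\<^sub>m Suc k) \<in> mat_tuples n d \<and> tuple_op n d N ^ Suc k = tuple_op n d (\<lambda>i. N i ^\<^sub>m Suc k)"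
proof (induction k)
  case 0
  have "N i ^\<^sub>m Suc 0 = N i" for i
    using N by (cases "i < n") (auto simp: mat_tuples_def not_less intro!: left_mult_one_mat)
  then show ?case using N by simp
next
  case (Suc k)
  have "tuple_op n d N ^ Suc (Suc k) = tuple_op n d (\<lambda>i. N i ^\<^sub>m Suc k) * tuple_op n d N"
    using Suc by (simp only: power_Suc2[of _ "Suc k"])
  also have "\<dots> = tuple_op n d (\<lambda>i. N i ^\<^sub>m Suc k * N i)"
    using Suc by (intro tuple_op_mult[symmetric] N) simp
  finally show ?case using mat_tuples_mult[of "\<lambda>i. N i ^\<^sub>m Suc k" n d N] Suc N by simp
qed

lemma tuple_op_zero: "tuple_op n d (\<lambda>i. if i < n then 0\<^sub>m (d i) (d i) else 0\<^sub>m 0 0) = 0"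
  by (rule op_eqI) (auto simp: tuple_op.rep_eq op_rep_eqs split: prod.splits)

lemma nilp_tuple_op_iff:
  assumes N: "N \<in> mat_tuples n d"
  shows "nilp (tuple_op n d N) \<longleftrightarrow> (\<forall>i<n. nilpotent_mat (N i))"
proof
  let ?z = "\<lambda>i. if i < n then 0\<^sub>m (d i) (d i) else 0\<^sub>m 0 0 :: 'a mat"
  have z: "?z \<in> mat_tuples n d" by (simp add: mat_tuples_def)
  have dims: "dim_row (N i) = d i" "dim_col (N i) = d i" if "i < n" for i
    using that N by (auto simp: mat_tuples_def)
  {
    assume "nilp (tuple_op n d N)"
    then obtain k where "tuple_op n d N ^ k = 0" by (auto simp: nilp_def)
    then have "tuple_op n d N ^ Suc k = 0" by simp
    then have "(\<lambda>i. N i ^\<^sub>m Suc k) = ?z"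
      using tuple_op_power[OF N, of k] z tuple_op_inj tuple_op_zero by metis
    then have "N i ^\<^sub>m Suc k = 0\<^sub>m (d i) (d i)" if "i < n" for i
      using that by (meson fun_cong)
    then show "\<forall>i<n. nilpotent_mat (N i)"
      unfolding nilpotent_mat_def using dims by (metis)
  }
  assume "\<forall>i<n. nilpotent_mat (N i)"
  then have "\<forall>i<n. \<exists>m. N i ^\<^sub>m m = 0\<^sub>m (d i) (d i)" using dims by (auto simp: nilpotent_mat_def)
  then obtain m where m: "\<And>i. i < n \<Longrightarrow> N i ^\<^sub>m m i = 0\<^sub>m (d i) (d i)" by metis
  \<comment> \<open>A single exponent that is at least every \<open>m i\<close>.\<close>
  define k where "k = (\<Sum>i<n. m i)"
  have "N i ^\<^sub>m Suc k = 0\<^sub>m (d i) (d i)" if i: "i < n" for i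
  proof -
    have c: "N i \<in> carrier_mat (d i) (d i)" using i N by (auto simp: mat_tuples_def)
    have "m i \<le> k" unfolding k_def using i by (intro member_le_sum) auto
    then obtain l where "Suc k = m i + l" using le_Suc_ex by (metis le_SucI)
    moreover have "N i ^\<^sub>m (m i + l) = 0\<^sub>m (d i) (d i)"
      by (induction l) (simp_all add: m[OF i] left_mult_zero_mat[OF c])
    ultimately show ?thesis by simp
  qed
  moreover have "N i ^\<^sub>m Suc k = 0\<^sub>m 0 0" if "\<not> i < n" for i
    using that tuple_op_power[OF N, of k] by (auto simp: mat_tuples_def)
  ultimately have "(\<lambda>i. N i ^\<^sub>m Suc k) = ?z" by (auto simp del: pow_mat.simps)
  then have "tuple_op n d N ^ Suc k = 0" using tuple_op_power[OF N, of k] tuple_op_zero by metis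
  then show "nilp (tuple_op n d N)" unfolding nilp_def by blast
qed

lemma End_repD:
  assumes "N \<in> End_rep n E src tgt d X"
  shows "i < n \<Longrightarrow> N i \<in> carrier_mat (d i) (d i)" "\<not> i < n \<Longrightarrow> N i = 0\<^sub>m 0 0"
    "e \<in> E \<Longrightarrow> N (tgt e) * X e = X e * N (src e)"
  using assms by (auto simp: End_rep_def)

lemma End_rep_mat_tuples: "End_rep n E src tgt d X \<subseteq> mat_tuples n d"
  by (auto simp: End_rep_def mat_tuples_def)

context
  fixes n :: nat and E :: "'e set" and src tgt :: "'e \<Rightarrow> nat" and d :: "nat \<Rightarrow> nat"
    and X :: "'e \<Rightarrow> 'k::field mat"
  assumes rep: "is_rep n E src tgt d X"
begin

lemma rep_arrow:
  assumes "e \<in> E"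
  shows "src e < n" "tgt e < n" "X e \<in> carrier_mat (d (tgt e)) (d (src e))"
  using rep assms by (auto simp: is_rep_def)

lemma End_rep_add:
  assumes N: "N \<in> End_rep n E src tgt d X" and M: "M \<in> End_rep n E src tgt d X"
  shows "(\<lambda>i. N i + M i) \<in> End_rep n E src tgt d X"
proof -
  have "(N (tgt e) + M (tgt e)) * X e = X e * (N (src e) + M (src e))" if e: "e \<in> E" for e
    using add_mult_distrib_mat[OF End_repD(1)[OF N rep_arrow(2)[OF e]] End_repD(1)[OF M rep_arrow(2)[OF e]] rep_arrow(3)[OF e]]
      mult_add_distrib_mat[OF rep_arrow(3)[OF e] End_repD(1)[OF N rep_arrow(1)[OF e]] End_repD(1)[OF M rep_arrow(1)[OF e]]]
      End_repD(3)[OF N e] End_repD(3)[OF M e] by simp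
  then show ?thesis using N M by (auto simp: End_rep_def)
qed

lemma End_rep_smult:
  assumes N: "N \<in> End_rep n E src tgt d X"
  shows "(\<lambda>i. c \<cdot>\<^sub>m N i) \<in> End_rep n E src tgt d X"
proof -
  have "(c \<cdot>\<^sub>m N (tgt e)) * X e = X e * (c \<cdot>\<^sub>m N (src e))" if e: "e \<in> E" for e
    using mult_smult_assoc_mat[OF End_repD(1)[OF N rep_arrow(2)[OF e]] rep_arrow(3)[OF e], of c]
      mult_smult_distrib[OF rep_arrow(3)[OF e] End_repD(1)[OF N rep_arrow(1)[OF e]], of c]
      End_repD(3)[OF N e] by simp
  then show ?thesis using N by (auto simp: End_rep_def)
qed

lemma End_rep_mult:
  assumes N: "N \<in> End_rep n E src tgt d X" and M: "M \<in> End_rep n E src tgt d X"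
  shows "(\<lambda>i. N i * M i) \<in> End_rep n E src tgt d X"
proof -
  have "(N (tgt e) * M (tgt e)) * X e = X e * (N (src e) * M (src e))" if e: "e \<in> E" for e
    using assoc_mult_mat[OF End_repD(1)[OF N rep_arrow(2)[OF e]] End_repD(1)[OF M rep_arrow(2)[OF e]] rep_arrow(3)[OF e]]
      assoc_mult_mat[OF End_repD(1)[OF N rep_arrow(2)[OF e]] rep_arrow(3)[OF e] End_repD(1)[OF M rep_arrow(1)[OF e]]]
      assoc_mult_mat[OF rep_arrow(3)[OF e] End_repD(1)[OF N rep_arrow(1)[OF e]] End_repD(1)[OF M rep_arrow(1)[OF e]]]
      End_repD(3)[OF N e] End_repD(3)[OF M e] by simp
  moreover have "\<forall>i<n. N i * M i \<in> carrier_mat (d i) (d i)" using mult_carrier_mat[OF End_repD(1)[OF N] End_repD(1)[OF M]] by simp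
  ultimately show ?thesis using N M by (auto simp: End_rep_def)
qed

lemma End_rep_one: "(\<lambda>i. if i < n then 1\<^sub>m (d i) else 0\<^sub>m 0 0) \<in> End_rep n E src tgt d X"
  using rep_arrow(1,2) left_mult_one_mat[OF rep_arrow(3)] right_mult_one_mat[OF rep_arrow(3)]
  by (auto simp: End_rep_def)

lemma End_rep_zero: "(\<lambda>i. if i < n then 0\<^sub>m (d i) (d i) else 0\<^sub>m 0 0) \<in> End_rep n E src tgt d X"
  using rep_arrow(1,2) left_mult_zero_mat[OF rep_arrow(3)] right_mult_zero_mat[OF rep_arrow(3)]
  by (auto simp: End_rep_def)

lemma fd_subalgebra_End_rep:
  "fd_subalgebra scale_op (tuple_op n d ` End_rep n E src tgt d X)
    ((\<lambda>(i, r, c). unit_op i r c) ` (SIGMA i:{..<n}. {..<d i} \<times> {..<d i}))"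
proof (intro fd_subalgebra.intro fd_subalgebra_axioms.intro)
  show "vector_space (scale_op :: 'k \<Rightarrow> _)" by unfold_locales
  show "scale_op c x * y = scale_op c (x * y)" for c and x y :: "'k linop"
    by (rule op_eqI) (simp add: op_rep_eqs)
  show "x * scale_op c y = scale_op c (x * y)" for c and x y :: "'k linop"
    by (rule op_eqI) (simp add: op_rep_eqs apply_op_cmult)
  have tup: "N \<in> mat_tuples n d" if "N \<in> End_rep n E src tgt d X" for N
    using that End_rep_mat_tuples by blast
  show "linop.subspace (tuple_op n d ` End_rep n E src tgt d X)"
  proof (rule linop.subspaceI)
    show "0 \<in> tuple_op n d ` End_rep n E src tgt d X"
      using imageI[OF End_rep_zero, of "tuple_op n d"] by (simp only: tuple_op_zero)
    show "x + y \<in> tuple_op n d ` End_rep n E src tgt d X"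
      if "x \<in> tuple_op n d ` End_rep n E src tgt d X" "y \<in> tuple_op n d ` End_rep n E src tgt d X" for x y
      using that imageI[OF End_rep_add, of _ _ "tuple_op n d"] by (auto simp: tuple_op_add tup)
    show "scale_op c x \<in> tuple_op n d ` End_rep n E src tgt d X"
      if "x \<in> tuple_op n d ` End_rep n E src tgt d X" for c x
      using that imageI[OF End_rep_smult, of _ "tuple_op n d"] by (auto simp: tuple_op_scale tup)
  qed
  show "x * y \<in> tuple_op n d ` End_rep n E src tgt d X"
    if "x \<in> tuple_op n d ` End_rep n E src tgt d X" "y \<in> tuple_op n d ` End_rep n E src tgt d X" for x y
    using that imageI[OF End_rep_mult, of _ _ "tuple_op n d"] by (auto simp: tuple_op_mult tup)
  show "finite ((\<lambda>(i, r, c). unit_op i r c :: 'k linop) ` (SIGMA i:{..<n}. {..<d i} \<times> {..<d i}))"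
    by (intro finite_imageI finite_SigmaI) auto
  show "tuple_op n d ` End_rep n E src tgt d X \<subseteq>
      linop.span ((\<lambda>(i, r, c). unit_op i r c) ` (SIGMA i:{..<n}. {..<d i} \<times> {..<d i}))"
    using tuple_op_in_span by blast
qed

text \<open>The abstract theorem for \<open>f\<close> the operator of the identity tuple, whose
  corner is the whole endomorphism algebra; injectivity of \<open>tuple_op\<close> on tuples
  translates back.\<close>

lemma NEnd_conj_into_subspace:
  obtains U where "U \<subseteq> NEnd n E src tgt d X"
    "\<And>N M. N \<in> U \<Longrightarrow> M \<in> U \<Longrightarrow> (\<lambda>i. N i + M i) \<in> U"
    "\<And>c N. N \<in> U \<Longrightarrow> (\<lambda>i. c \<cdot>\<^sub>m N i) \<in> U"
    "\<And>N. N \<in> NEnd n E src tgt d X \<Longrightarrow> \<exists>g\<in>End_rep n E src tgt d X. \<exists>h\<in>End_rep n E src tgt d X.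
       (\<forall>i<n. g i * h i = 1\<^sub>m (d i) \<and> h i * g i = 1\<^sub>m (d i)) \<and> (\<lambda>i. h i * N i * g i) \<in> U"
proof -
  let ?E = "End_rep n E src tgt d X"
  let ?one = "\<lambda>i. if i < n then 1\<^sub>m (d i) else 0\<^sub>m 0 0 :: 'k mat"
  interpret A: fd_subalgebra scale_op "tuple_op n d ` ?E"
    "(\<lambda>(i, r, c). unit_op i r c) ` (SIGMA i:{..<n}. {..<d i} \<times> {..<d i})"
    by (rule fd_subalgebra_End_rep)
  have tup: "N \<in> mat_tuples n d" if "N \<in> ?E" for N using that End_rep_mat_tuples by blast
  have one: "(\<lambda>i. ?one i * N i) = N" "(\<lambda>i. N i * ?one i) = N" if "N \<in> ?E" for N
    using End_repD(2)[OF that] left_mult_one_mat[OF End_repD(1)[OF that]] right_mult_one_mat[OF End_repD(1)[OF that]]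
    by (auto simp: fun_eq_iff)
  define f where "f = tuple_op n d ?one"
  have f1: "f * tuple_op n d N = tuple_op n d N" "tuple_op n d N * f = tuple_op n d N" if N: "N \<in> ?E" for N
    unfolding f_def using one[OF N] tuple_op_mult[OF tup[OF End_rep_one] tup[OF N]]
      tuple_op_mult[OF tup[OF N] tup[OF End_rep_one]] by simp_all
  have idem: "A.idem f" using f1[OF End_rep_one] End_rep_one by (auto simp: A.idem_def f_def)
  have corner: "A.corner f = tuple_op n d ` ?E" using f1 by (auto simp: A.corner_def)
  obtain U where U: "linop.subspace U" "U \<subseteq> tuple_op n d ` ?E" "\<And>x. x \<in> U \<Longrightarrow> nilp x"
    and conj: "\<And>a. a \<in> tuple_op n d ` ?E \<Longrightarrow> nilp a \<Longrightarrow> \<exists>g h. A.mutual_inverse f g h \<and> h * a * g \<in> U"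
    using A.nilpotents_conj_into_subspace[OF idem] unfolding corner by blast
  define V where "V = {N \<in> ?E. tuple_op n d N \<in> U}"
  show ?thesis
  proof (rule that[of V])
    show "V \<subseteq> NEnd n E src tgt d X"
      using U(3) nilp_tuple_op_iff[OF tup] by (auto simp: V_def NEnd_def)
    show "(\<lambda>i. N i + M i) \<in> V" if "N \<in> V" "M \<in> V" for N M
      using that tup linop.subspace_add[OF U(1)] by (auto simp: V_def End_rep_add tuple_op_add)
    show "(\<lambda>i. c \<cdot>\<^sub>m N i) \<in> V" if "N \<in> V" for c N
      using that tup linop.subspace_scale[OF U(1)] by (auto simp: V_def End_rep_smult tuple_op_scale)
    fix N assume "N \<in> NEnd n E src tgt d X"
    then have N: "N \<in> ?E" "nilp (tuple_op n d N)"
      using nilp_tuple_op_iff[OF tup] by (auto simp: NEnd_def)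
    obtain g' h' where gh': "A.mutual_inverse f g' h'" "h' * tuple_op n d N * g' \<in> U"
      using conj[OF _ N(2)] N(1) by blast
    then obtain g h where gh: "g \<in> ?E" "h \<in> ?E" "g' = tuple_op n d g" "h' = tuple_op n d h"
      by (auto simp: A.mutual_inverse_def corner)
    have "tuple_op n d (\<lambda>i. g i * h i) = tuple_op n d ?one" "tuple_op n d (\<lambda>i. h i * g i) = tuple_op n d ?one"
      using gh' gh tup by (simp_all add: A.mutual_inverse_def f_def tuple_op_mult)
    then have "(\<lambda>i. g i * h i) = ?one" "(\<lambda>i. h i * g i) = ?one"
      using tuple_op_inj tup End_rep_mult End_rep_one gh by blast+
    then have "\<forall>i<n. g i * h i = 1\<^sub>m (d i) \<and> h i * g i = 1\<^sub>m (d i)" by (auto simp: fun_eq_iff)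
    moreover have "(\<lambda>i. h i * N i * g i) \<in> V"
      using gh gh' N(1) tup by (simp add: V_def End_rep_mult tuple_op_mult)
    ultimately show "\<exists>g\<in>?E. \<exists>h\<in>?E. (\<forall>i<n. g i * h i = 1\<^sub>m (d i) \<and> h i * g i = 1\<^sub>m (d i)) \<and> (\<lambda>i. h i * N i * g i) \<in> V"
      using gh by blast
  qed
qed

end

section \<open>Minors and semicontinuity of kernel dimensions\<close>

text \<open>Instantiated twice, with polynomials in the entries of a tuple and with polynomials in a
  curve parameter, so that determinants, powers and adjugates are treated once.\<close>

locale function_subalgebra =
  fixes S :: "('x \<Rightarrow> 'k::field) set"
  assumes const: "(\<lambda>_. c) \<in> S"
    and add: "f \<in> S \<Longrightarrow> g \<in> S \<Longrightarrow> (\<lambda>x. f x + g x) \<in> S"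
    and mult: "f \<in> S \<Longrightarrow> g \<in> S \<Longrightarrow> (\<lambda>x. f x * g x) \<in> S"
begin

lemma sum: "(\<And>i. i \<in> I \<Longrightarrow> f i \<in> S) \<Longrightarrow> (\<lambda>x. \<Sum>i\<in>I. f i x) \<in> S"
  by (induction I rule: infinite_finite_induct) (simp_all add: const add)

lemma prod: "(\<And>i. i \<in> I \<Longrightarrow> f i \<in> S) \<Longrightarrow> (\<lambda>x. \<Prod>i\<in>I. f i x) \<in> S"
  by (induction I rule: infinite_finite_induct) (simp_all add: const mult)

definition entries :: "nat \<Rightarrow> nat \<Rightarrow> ('x \<Rightarrow> 'k mat) \<Rightarrow> bool" where
  "entries nr nc M \<longleftrightarrow> (\<forall>x. M x \<in> carrier_mat nr nc) \<and> (\<forall>i<nr. \<forall>j<nc. (\<lambda>x. M x $$ (i, j)) \<in> S)"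

lemma entriesD: "entries nr nc M \<Longrightarrow> M x \<in> carrier_mat nr nc"
  "entries nr nc M \<Longrightarrow> i < nr \<Longrightarrow> j < nc \<Longrightarrow> (\<lambda>x. M x $$ (i, j)) \<in> S"
  by (auto simp: entries_def)

lemma entries_const: "A \<in> carrier_mat nr nc \<Longrightarrow> entries nr nc (\<lambda>_. A)"
  by (simp add: entries_def const)

lemma entries_cong:
  assumes "\<And>x. M x \<in> carrier_mat nr nc"
    and "\<And>x i j. i < nr \<Longrightarrow> j < nc \<Longrightarrow> M x $$ (i, j) = m i j x"
    and "\<And>i j. i < nr \<Longrightarrow> j < nc \<Longrightarrow> m i j \<in> S"
  shows "entries nr nc M"
  using assms by (simp add: entries_def)

lemma entries_add:
  assumes "entries nr nc M" "entries nr nc N" shows "entries nr nc (\<lambda>x. M x + N x)"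
proof (rule entries_cong[where m = "\<lambda>i j x. M x $$ (i, j) + N x $$ (i, j)"])
  show "M x + N x \<in> carrier_mat nr nc" for x using entriesD(1)[OF assms(2)] by simp
  show "(M x + N x) $$ (i, j) = M x $$ (i, j) + N x $$ (i, j)" if "i < nr" "j < nc" for x i j
    using that entriesD(1)[OF assms(2), of x] by auto
qed (intro add entriesD(2)[OF assms(1)] entriesD(2)[OF assms(2)])

lemma entries_smult:
  assumes "f \<in> S" "entries nr nc N" shows "entries nr nc (\<lambda>x. f x \<cdot>\<^sub>m N x)"
proof (rule entries_cong[where m = "\<lambda>i j x. f x * N x $$ (i, j)"])
  show "f x \<cdot>\<^sub>m N x \<in> carrier_mat nr nc" for x using entriesD(1)[OF assms(2)] by simp
  show "(f x \<cdot>\<^sub>m N x) $$ (i, j) = f x * N x $$ (i, j)" if "i < nr" "j < nc" for x i j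
    using that entriesD(1)[OF assms(2), of x] by auto
qed (intro mult assms(1) entriesD(2)[OF assms(2)])

lemma entries_mult:
  assumes M: "entries nr n M" and N: "entries n nc N" shows "entries nr nc (\<lambda>x. M x * N x)"
proof (rule entries_cong[where m = "\<lambda>i j x. \<Sum>k\<in>{0..<n}. M x $$ (i, k) * N x $$ (k, j)"])
  show "M x * N x \<in> carrier_mat nr nc" for x
    using mult_carrier_mat[OF entriesD(1)[OF M] entriesD(1)[OF N]] .
  fix x i j assume "i < nr" "j < nc"
  then show "(M x * N x) $$ (i, j) = (\<Sum>k\<in>{0..<n}. M x $$ (i, k) * N x $$ (k, j))"
    using entriesD(1)[OF M, of x] entriesD(1)[OF N, of x] by (simp add: scalar_prod_def)
  fix i j assume ij: "i < nr" "j < nc"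
  show "(\<lambda>x. \<Sum>k\<in>{0..<n}. M x $$ (i, k) * N x $$ (k, j)) \<in> S"
    by (rule sum, rule mult; (rule entriesD(2)[OF M] entriesD(2)[OF N]; use ij in simp))
qed

lemma entries_power:
  assumes M: "entries n n M" shows "entries n n (\<lambda>x. M x ^\<^sub>m k)"
proof (induction k)
  case 0
  have "M x ^\<^sub>m 0 = 1\<^sub>m n" for x using entriesD(1)[OF M, of x] by simp
  then show ?case using entries_const[of "1\<^sub>m n"] by simp
qed (simp add: entries_mult M)

lemma det:
  assumes M: "entries n n M" shows "(\<lambda>x. det (M x)) \<in> S"
proof -
  have "(\<lambda>x. det (M x)) = (\<lambda>x. \<Sum>p | p permutes {0..<n}. signof p * (\<Prod>i = 0..<n. M x $$ (i, p i)))"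
    by (rule ext) (rule det_def'[OF entriesD(1)[OF M]])
  moreover have "(\<lambda>x. \<Sum>p | p permutes {0..<n}. signof p * (\<Prod>i = 0..<n. M x $$ (i, p i))) \<in> S"
    by (intro sum mult const prod entriesD(2)[OF M]) (auto simp: permutes_in_image)
  ultimately show ?thesis by simp
qed

lemma entries_adj_mat:
  assumes M: "entries n n M" shows "entries n n (\<lambda>x. adj_mat (M x))"
proof (rule entries_cong[where m = "\<lambda>i j x. cofactor (M x) j i"])
  show "adj_mat (M x) \<in> carrier_mat n n" for x using adj_mat(1)[OF entriesD(1)[OF M]] .
  show "adj_mat (M x) $$ (i, j) = cofactor (M x) j i" if "i < n" "j < n" for x i j
    using that entriesD(1)[OF M, of x] by (simp add: adj_mat_def)
  fix i j assume ij: "i < n" "j < n"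
  have "entries (n - 1) (n - 1) (\<lambda>x. mat_delete (M x) j i)"
  proof (rule entries_cong[where m = "\<lambda>r c x. M x $$ (insert_index j r, insert_index i c)"])
    show "mat_delete (M x) j i \<in> carrier_mat (n - 1) (n - 1)" for x
      using entriesD(1)[OF M, of x] by (rule mat_delete_carrier)
    fix r c assume rc: "r < n - 1" "c < n - 1"
    show "mat_delete (M x) j i $$ (r, c) = M x $$ (insert_index j r, insert_index i c)" for x
      using mat_delete_index[of "M x" "n - 1" j i r c] entriesD(1)[OF M, of x] ij rc by simp
    show "(\<lambda>x. M x $$ (insert_index j r, insert_index i c)) \<in> S"
      using rc by (intro entriesD(2)[OF M]) (auto simp: insert_index_def)
  qed
  then show "(\<lambda>x. cofactor (M x) j i) \<in> S"
    unfolding cofactor_def by (intro mult const det)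
qed

end

section \<open>Rank and compressed determinants\<close>

text \<open>Only the nonzero rows of \<open>Y\<close> contribute. Both factors can therefore be cut
  down to these rows and padded with zeros to size \<open>r\<close>; the left one then has a zero
  column, and \<open>det\<close> is multiplicative on square matrices.\<close>

lemma det_mult_few_rows:
  fixes X Y :: "'k::field mat"
  assumes X: "X \<in> carrier_mat r n" and Y: "Y \<in> carrier_mat n r"
    and few: "card {i. i < n \<and> row Y i \<noteq> 0\<^sub>v r} < r"
  shows "det (X * Y) = 0"
proof -
  let ?I = "{i. i < n \<and> row Y i \<noteq> 0\<^sub>v r}"
  obtain h where h: "bij_betw h {0..<card ?I} ?I"
    using ex_bij_betw_nat_finite[of ?I] by auto
  define X' where "X' = mat r r (\<lambda>(a, b). if b < card ?I then X $$ (a, h b) else 0)"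
  define Y' where "Y' = mat r r (\<lambda>(b, c). if b < card ?I then Y $$ (h b, c) else 0)"
  have "X * Y = X' * Y'"
  proof (rule eq_matI)
    fix a c assume "a < dim_row (X' * Y')" "c < dim_col (X' * Y')"
    then have ac: "a < r" "c < r" by (simp_all add: X'_def Y'_def)
    have "Y $$ (i, c) = 0" if "i < n" "i \<notin> ?I" for i
      using that ac Y by (metis (mono_tags, lifting) carrier_matD index_row(1) index_zero_vec(1) mem_Collect_eq)
    then have "(X * Y) $$ (a, c) = (\<Sum>i\<in>?I. X $$ (a, i) * Y $$ (i, c))"
      using X Y ac by (simp add: scalar_prod_def) (intro sum.mono_neutral_right; auto)
    also have "\<dots> = (\<Sum>b\<in>{0..<card ?I}. X $$ (a, h b) * Y $$ (h b, c))"
      by (rule sum.reindex_bij_betw[OF h, symmetric])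
    also have "\<dots> = (\<Sum>b\<in>{0..<r}. X' $$ (a, b) * Y' $$ (b, c))"
      using few ac by (intro sum.mono_neutral_cong_left) (auto simp: X'_def Y'_def)
    also have "\<dots> = (X' * Y') $$ (a, c)"
      using ac by (simp add: X'_def Y'_def scalar_prod_def)
    finally show "(X * Y) $$ (a, c) = (X' * Y') $$ (a, c)" .
  qed (use X Y in \<open>auto simp: X'_def Y'_def\<close>)
  moreover have "det X' = 0"
  proof -
    have c: "X' \<in> carrier_mat r r" by (simp add: X'_def)
    have "X' *\<^sub>v unit_vec r (card ?I) = 0\<^sub>v r"
      using few by (intro eq_vecI) (auto simp: X'_def)
    moreover have "unit_vec r (card ?I) \<noteq> (0\<^sub>v r :: 'k vec)" using few by (rule unit_vec_nonzero)
    ultimately show ?thesis using det_0_iff_vec_prod_zero_field[OF c] by (meson unit_vec_carrier)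
  qed
  ultimately show ?thesis by (simp add: det_mult[of _ r] X'_def Y'_def)
qed

lemma kernel_dim_pivots:
  fixes A :: "'k::field mat"
  assumes A: "A \<in> carrier_mat n n"
  obtains C P Q f where "C \<in> carrier_mat n n" "P \<in> carrier_mat n n" "Q \<in> carrier_mat n n"
    "C = P * A" "A = Q * C" "pivot_fun C f n"
    "kernel_dim A = n - card {i. i < n \<and> row C i \<noteq> 0\<^sub>v n}"
    "{i. i < n \<and> row C i \<noteq> 0\<^sub>v n} = {i. i < n \<and> f i < n}"
proof -
  obtain C where gj: "gauss_jordan_single A = C" by auto
  from gauss_jordan_single[OF A gj] obtain P Q where C: "C = P * A" "C \<in> carrier_mat n n"
    and row: "row_echelon_form C"
    and PQ: "P \<in> carrier_mat n n" "Q \<in> carrier_mat n n" "Q * P = 1\<^sub>m n"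
    by auto
  obtain f where f: "pivot_fun C f n" using row C(2) by (auto simp: row_echelon_form_def)
  have "A = Q * C" using C(1) PQ A assoc_mult_mat[OF PQ(2,1) A] by simp
  moreover have "kernel_dim A = n - card {i. i < n \<and> row C i \<noteq> 0\<^sub>v n}"
    using kernel_dim_code[of A] A pivot_positions(4)[OF C(2) f] by (simp add: gj)
  moreover have "{i. i < n \<and> row C i \<noteq> 0\<^sub>v n} = {i. i < n \<and> f i < n}"
    using pivot_fun_zero_row_iff[OF f C(2)] pivot_funD(1)[OF _ f] C(2) by (auto simp: order.strict_iff_order)
  ultimately show ?thesis using that C PQ f by blast
qed

text \<open>In \<open>A = Q * C\<close> the reduced echelon form \<open>C\<close> has as many
  nonzero rows as the rank of \<open>A\<close>, and \<open>C * V\<close> has no more. Arbitrary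
  constant \<open>U\<close> and \<open>V\<close> serve as well as row and column selections, since
  the determinant stays polynomial in \<open>A\<close>.\<close>

lemma kernel_dim_le_of_minor:
  fixes A :: "'k::field mat"
  assumes A: "A \<in> carrier_mat n n" and U: "U \<in> carrier_mat r n" and V: "V \<in> carrier_mat n r"
    and det: "det (U * A * V) \<noteq> 0"
  shows "kernel_dim A \<le> n - r"
proof (rule kernel_dim_pivots[OF A])
  fix C P Q f
  assume C: "C \<in> carrier_mat n n" and Q: "Q \<in> carrier_mat n n" and AQC: "A = Q * C"
    and kd: "kernel_dim A = n - card {i. i < n \<and> row C i \<noteq> 0\<^sub>v n}"
  have "U * A * V = (U * Q) * (C * V)"
    unfolding AQC using assoc_mult_mat[OF U Q C] assoc_mult_mat[of "U * Q" r n C n V r] U V Q C by simp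
  then have "\<not> card {i. i < n \<and> row (C * V) i \<noteq> 0\<^sub>v r} < r"
    using det det_mult_few_rows[of "U * Q" r n "C * V"] U V Q C by auto
  moreover have "card {i. i < n \<and> row (C * V) i \<noteq> 0\<^sub>v r} \<le> card {i. i < n \<and> row C i \<noteq> 0\<^sub>v n}"
  proof (rule card_mono)
    show "{i. i < n \<and> row (C * V) i \<noteq> 0\<^sub>v r} \<subseteq> {i. i < n \<and> row C i \<noteq> 0\<^sub>v n}"
    proof clarify
      fix i assume "i < n" "row C i = 0\<^sub>v n" "row (C * V) i \<noteq> 0\<^sub>v r"
      moreover have "row (C * V) i = 0\<^sub>v r" 
        by (rule eq_vecI) (use calculation(1,2) C V in \<open>simp_all del: row_mult\<close>)
      ultimately show False by simp
    qed
  qed simp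
  ultimately show ?thesis using kd by linarith
qed

text \<open>Here \<open>r\<close> is the rank: \<open>U\<close> consists of the rows of
  \<open>P\<close> producing the nonzero rows of the echelon form, and \<open>V\<close> selects the
  pivot columns, where these rows form an identity matrix.\<close>

lemma kernel_dim_minor_exists:
  fixes A :: "'k::field mat"
  assumes A: "A \<in> carrier_mat n n"
  obtains r U V where "U \<in> carrier_mat r n" "V \<in> carrier_mat n r" "det (U * A * V) \<noteq> 0"
    "kernel_dim A = n - r"
proof (rule kernel_dim_pivots[OF A])
  fix C P Q f
  assume C: "C \<in> carrier_mat n n" and P: "P \<in> carrier_mat n n" and CPA: "C = P * A"
    and f: "pivot_fun C f n"
    and kd: "kernel_dim A = n - card {i. i < n \<and> row C i \<noteq> 0\<^sub>v n}"
    and I: "{i. i < n \<and> row C i \<noteq> 0\<^sub>v n} = {i. i < n \<and> f i < n}"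
  define I where "I = {i. i < n \<and> f i < n}"
  define r where "r = card I"
  obtain h where h: "bij_betw h {0..<r} I"
    using ex_bij_betw_nat_finite[of I] by (auto simp: I_def r_def)
  have hI: "h a < n" "f (h a) < n" if "a < r" for a
    using bij_betwE[OF h] that by (auto simp: I_def)
  have hinj: "h a = h b \<longleftrightarrow> a = b" if "a < r" "b < r" for a b
    using bij_betw_imp_inj_on[OF h] that by (auto simp: inj_on_def)
  define U where "U = mat r n (\<lambda>(a, j). P $$ (h a, j))"
  define V where "V = mat n r (\<lambda>(j, b). if j = f (h b) then 1 else (0::'k))"
  have UA: "U * A = mat r n (\<lambda>(a, j). C $$ (h a, j))"
    using A P hI by (intro eq_matI) (auto simp: U_def CPA scalar_prod_def)
  have "U * A * V = 1\<^sub>m r"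
  proof (rule eq_matI)
    fix a b assume "a < dim_row (1\<^sub>m r :: 'k mat)" "b < dim_col (1\<^sub>m r :: 'k mat)"
    then have ab: "a < r" "b < r" by auto
    have "(U * A * V) $$ (a, b) = (\<Sum>j\<in>{0..<n}. C $$ (h a, j) * (if j = f (h b) then 1 else 0))"
      using ab unfolding UA by (simp add: V_def scalar_prod_def)
    also have "\<dots> = C $$ (h a, f (h b))"
      using hI(2)[OF ab(2)] by (simp add: if_distrib[of "\<lambda>x. _ * x"] cong: if_cong)
    also have "\<dots> = (1\<^sub>m r) $$ (a, b)"
      using pivot_funD(4,5)[OF _ f, of n "h b"] hI ab hinj C by auto
    finally show "(U * A * V) $$ (a, b) = (1\<^sub>m r) $$ (a, b)" .
  qed (auto simp: U_def V_def)
  then have "det (U * A * V) \<noteq> 0" by simp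
  then show ?thesis using that[of U r V] kd I by (simp add: U_def V_def r_def I_def)
qed

section \<open>Jordan types of nilpotent matrices\<close>

text \<open>The echelon form \<open>C = P * A\<close> of a singular matrix has last row zero, and
  multiplying by \<open>Q\<close>, the inverse of \<open>P\<close>, on the right keeps it zero while
  making the result a conjugate of \<open>A\<close>.\<close>

lemma similar_mat_zero_last_row:
  fixes A :: "'k::field mat"
  assumes A: "A \<in> carrier_mat (Suc n) (Suc n)" and det: "det A = 0"
  obtains B where "B \<in> carrier_mat (Suc n) (Suc n)" "similar_mat A B" "row B n = 0\<^sub>v (Suc n)"
proof -
  let ?n = "Suc n"
  obtain C where gj: "gauss_jordan_single A = C" by auto
  from gauss_jordan_single[OF A gj] obtain P Q where C: "C = P * A" "C \<in> carrier_mat ?n ?n"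
    and row: "row_echelon_form C"
    and PQ: "P \<in> carrier_mat ?n ?n" "Q \<in> carrier_mat ?n ?n" "P * Q = 1\<^sub>m ?n" "Q * P = 1\<^sub>m ?n"
    by auto
  have "det C = 0" using C PQ A det by (simp add: det_mult)
  then have "C \<noteq> 1\<^sub>m ?n" by auto
  then have r: "row C n = 0\<^sub>v ?n" using row_echelon_form_imp_1_or_0_row[OF C(2) row] by auto
  have "row (C * Q) n = 0\<^sub>v ?n"
  proof (rule eq_vecI)
    fix j assume "j < dim_vec (0\<^sub>v ?n :: 'k vec)"
    then show "row (C * Q) n $ j = 0\<^sub>v ?n $ j" using C(2) PQ(2) r by (simp del: row_mult)
  qed (use PQ in simp)
  moreover have "similar_mat A (C * Q)"
  proof (rule similar_matI[of _ _ Q P ?n])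
    have "Q * (C * Q) * P = Q * C * (Q * P)" using C(2) PQ by (simp add: assoc_mult_mat[of _ ?n ?n _ ?n _ ?n])
    also have "Q * C = (Q * P) * A" unfolding C(1) using assoc_mult_mat[OF PQ(2,1) A] by simp
    also have "(Q * P) * A * (Q * P) = A" using PQ A by simp
    finally show "A = Q * (C * Q) * P" ..
  qed (use A C(2) PQ in auto)
  ultimately show ?thesis using that[of "C * Q"] C(2) PQ by auto
qed

lemma nilpotent_mat_similar_upper_triangular:
  fixes A :: "'k::field mat"
  assumes "A \<in> carrier_mat n n" "nilpotent_mat A"
  shows "\<exists>B. B \<in> carrier_mat n n \<and> upper_triangular B \<and> similar_mat A B"
  using assms
proof (induction n arbitrary: A)
  case 0
  then show ?case by (intro exI[of _ A]) (auto intro: similar_mat_refl)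
next
  case (Suc n)
  let ?n = "Suc n"
  note A = Suc.prems(1)
  obtain m where m: "A ^\<^sub>m m = 0\<^sub>m ?n ?n" using Suc.prems by (auto simp: nilpotent_mat_def)
  have "det (A ^\<^sub>m k) = det A ^ k" for k
    by (induction k) (use A in \<open>simp_all add: det_mult[of _ ?n]\<close>)
  from this[of m] have "det A = 0" by (simp add: m)
  then obtain B where B: "B \<in> carrier_mat ?n ?n" "similar_mat A B" "row B n = 0\<^sub>v ?n"
    using similar_mat_zero_last_row[OF A] by blast
  obtain B1 B2 B3 B4 where sb: "split_block B n n = (B1, B2, B3, B4)" by (metis prod_cases4)
  note sb' = split_block[OF sb, of 1 1]
  have Bs: "B1 \<in> carrier_mat n n" "B2 \<in> carrier_mat n 1" "B3 \<in> carrier_mat 1 n" "B4 \<in> carrier_mat 1 1"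
    "B = four_block_mat B1 B2 B3 B4"
    using sb' B(1) by auto
  have last: "B $$ (n, j) = 0" if "j < ?n" for j
    using arg_cong[OF B(3), of "\<lambda>v. v $ j"] that B(1) by simp
  have "B3 = 0\<^sub>m 1 n" "B4 = 0\<^sub>m 1 1"
    using sb B(1) last by (auto simp: split_block_def Let_def intro!: eq_matI)
  note Beq = Bs(5)[unfolded this]
  have ut: "upper_triangular (0\<^sub>m 1 1 :: 'k mat)" by auto
  have "B ^\<^sub>m m = 0\<^sub>m ?n ?n"
  proof -
    obtain P Q where PQ: "similar_mat_wit B A P Q"
      using similar_mat_sym[OF B(2)] by (auto simp: similar_mat_def)
    then show ?thesis
      using similar_mat_wit_pow_id[OF PQ, of m] similar_mat_witD2[OF B(1) PQ] by (simp add: m)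
  qed
  \<comment> \<open>The upper left block of a power is the power of the block, so \<open>B1\<close>
    inherits nilpotency.\<close>
  have "\<exists>D. B ^\<^sub>m k = four_block_mat (B1 ^\<^sub>m k) D (0\<^sub>m 1 n) (0\<^sub>m 1 1 ^\<^sub>m k) \<and> D \<in> carrier_mat n 1" for k
  proof (induction k)
    case 0
    show ?case using Bs(1) Beq by (intro exI[of _ "0\<^sub>m n 1"]) auto
  next
    case (Suc k)
    then obtain D where D: "B ^\<^sub>m k = four_block_mat (B1 ^\<^sub>m k) D (0\<^sub>m 1 n) (0\<^sub>m 1 1 ^\<^sub>m k)" "D \<in> carrier_mat n 1"
      by blast
    let ?z = "0\<^sub>m 1 1 :: 'k mat" and ?D = "B1 ^\<^sub>m k * B2 + D * 0\<^sub>m 1 1"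
    have z: "?z ^\<^sub>m k \<in> carrier_mat 1 1" by (rule pow_carrier_mat) simp
    have "B ^\<^sub>m Suc k = four_block_mat (B1 ^\<^sub>m k) D (0\<^sub>m 1 n) (?z ^\<^sub>m k) * four_block_mat B1 B2 (0\<^sub>m 1 n) ?z"
      using D(1) Beq by simp
    also have "\<dots> = four_block_mat (B1 ^\<^sub>m k * B1 + D * 0\<^sub>m 1 n) ?D
        (0\<^sub>m 1 n * B1 + ?z ^\<^sub>m k * 0\<^sub>m 1 n) (0\<^sub>m 1 n * B2 + ?z ^\<^sub>m k * ?z)"
      by (rule mult_four_block_mat) (use Bs(1,2) D(2) z in auto)
    also have "\<dots> = four_block_mat (B1 ^\<^sub>m Suc k) ?D (0\<^sub>m 1 n) (?z ^\<^sub>m Suc k)"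
      using Bs(1,2) D(2) z by (intro cong_four_block_mat) auto
    finally show ?case using Bs(1,2) D(2) by (intro exI[of _ ?D]) auto
  qed
  then obtain D where D: "0\<^sub>m ?n ?n = four_block_mat (B1 ^\<^sub>m m) D (0\<^sub>m 1 n) (0\<^sub>m 1 1 ^\<^sub>m m)" "D \<in> carrier_mat n 1"
    using \<open>B ^\<^sub>m m = 0\<^sub>m ?n ?n\<close> by metis
  have "B1 ^\<^sub>m m = 0\<^sub>m n n"
  proof (rule eq_matI)
    fix i j assume "i < dim_row (0\<^sub>m n n :: 'k mat)" "j < dim_col (0\<^sub>m n n :: 'k mat)"
    moreover have "B1 ^\<^sub>m m \<in> carrier_mat n n" using Bs(1) by simp
    ultimately show "(B1 ^\<^sub>m m) $$ (i, j) = 0\<^sub>m n n $$ (i, j)"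
      using arg_cong[OF D(1), of "\<lambda>M. M $$ (i, j)"] by (simp del: pow_mat_dim)
  qed (use Bs(1) in auto)
  then have "nilpotent_mat B1" using Bs(1) unfolding nilpotent_mat_def by auto
  then obtain T where T: "T \<in> carrier_mat n n" "upper_triangular T" "similar_mat B1 T"
    using Suc.IH[OF Bs(1)] by blast
  obtain B0 where B0: "B0 \<in> carrier_mat n 1"
    "similar_mat B (four_block_mat T B0 (0\<^sub>m 1 n) (0\<^sub>m 1 1))"
    using similar_mat_four_block_0_ex[OF T(3) similar_mat_refl[of "0\<^sub>m 1 1" 1] Bs(2,1)] Beq by auto
  let ?T = "four_block_mat T B0 (0\<^sub>m 1 n) (0\<^sub>m 1 1)"
  have "?T \<in> carrier_mat ?n ?n" using four_block_carrier_mat[OF T(1), of "0\<^sub>m 1 1" 1 1] by simp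
  moreover have "upper_triangular ?T" using T by (intro upper_triangular_four_block[of _ n _ 1] ut) auto
  moreover have "similar_mat A ?T" using similar_mat_trans[OF B(2) B0(2)] .
  ultimately show ?case by blast
qed

lemma zero_mult_mat_vec_eq: "v \<in> carrier_vec nc \<Longrightarrow> 0\<^sub>m nr nc *\<^sub>v v = 0\<^sub>v nr"
  by (intro eq_vecI) auto

lemma nilpotent_mat_eigenvalue:
  fixes A :: "'k::field mat"
  assumes A: "A \<in> carrier_mat n n" and nil: "nilpotent_mat A" and root: "poly (char_poly A) a = 0"
  shows "a = 0"
proof -
  obtain m where m: "A ^\<^sub>m m = 0\<^sub>m n n" using assms by (auto simp: nilpotent_mat_def)
  obtain v where v: "eigenvector A v a"
    using root eigenvalue_root_char_poly[OF A] by (auto simp: eigenvalue_def)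
  have vc: "v \<in> carrier_vec n" "v \<noteq> 0\<^sub>v n" using v A by (auto simp: eigenvector_def)
  have "a ^ m \<cdot>\<^sub>v v = 0\<^sub>v n" using eigenvector_pow[OF A v, of m] vc(1) by (simp add: m zero_mult_mat_vec_eq)
  moreover obtain i where "i < n" "v $ i \<noteq> 0"
    using vc by (metis eq_vecI carrier_vecD index_zero_vec)
  ultimately have "a ^ m * v $ i = 0" 
    using vc(1) arg_cong[of "a ^ m \<cdot>\<^sub>v v" "0\<^sub>v n" "\<lambda>w. w $ i"] by (metis carrier_vecD index_smult_vec(1) index_zero_vec(1))
  with \<open>v $ i \<noteq> 0\<close> show ?thesis by simp
qed

lemma nilpotent_jordan_nf:
  fixes A :: "'k::field mat"
  assumes A: "A \<in> carrier_mat n n" and nil: "nilpotent_mat A"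
  shows "\<exists>n_as. jordan_nf A n_as"
proof -
  obtain B where B: "B \<in> carrier_mat n n" "upper_triangular B" "similar_mat A B"
    using nilpotent_mat_similar_upper_triangular[OF assms] by blast
  have "jordan_nf B (triangular_to_jnf_vector B)" using B by (intro triangular_to_jnf_vector)
  then show ?thesis using B(3) similar_mat_trans unfolding jordan_nf_def by blast
qed

lemma nilpotent_jordan_nf_zero:
  fixes A :: "'k::field mat"
  assumes A: "A \<in> carrier_mat n n" and nil: "nilpotent_mat A" and jnf: "jordan_nf A n_as"
    and mem: "(m, a) \<in> set n_as"
  shows "a = 0"
proof (rule nilpotent_mat_eigenvalue[OF A nil])
  have "m > 0" using jnf mem unfolding jordan_nf_def by force
  moreover have "[:- a, 1:] ^ m dvd char_poly A"
    unfolding jordan_nf_char_poly[OF jnf] using mem by (force intro!: prod_list_dvd)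
  ultimately have "[:- a, 1:] dvd char_poly A" by (meson dvd_power dvd_trans)
  then show "poly (char_poly A) a = 0" by (simp add: poly_eq_0_iff_dvd)
qed

text \<open>Whichever Jordan form \<open>SOME\<close> picks, all eigenvalues are 0, and the
  \<open>k\<close>-th power of a nilpotent block of size \<open>m\<close> has a kernel of dimension
  \<open>min k m\<close>.\<close>

lemma JF_mat_props:
  fixes A :: "'k::field mat"
  assumes A: "A \<in> carrier_mat n n" and nil: "nilpotent_mat A"
  shows "sorted (rev (JF_mat A))" "0 \<notin> set (JF_mat A)" "sum_list (JF_mat A) = n"
    "kernel_dim (A ^\<^sub>m k) = (\<Sum>m\<leftarrow>JF_mat A. min k m)"
proof -
  define n_as where "n_as = (SOME n_as. jordan_nf A n_as)"
  have jnf: "jordan_nf A n_as" unfolding n_as_def by (rule someI_ex[OF nilpotent_jordan_nf[OF assms]])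
  have JF: "JF_mat A = rev (sort (map fst n_as))" by (simp add: JF_mat_def n_as_def)
  show "sorted (rev (JF_mat A))" by (simp add: JF)
  show "0 \<notin> set (JF_mat A)" using jnf by (auto simp: JF jordan_nf_def)
  have sum: "(\<Sum>m\<leftarrow>JF_mat A. f m) = (\<Sum>m\<leftarrow>map fst n_as. f m)" for f :: "nat \<Rightarrow> nat"
  proof -
    have "mset (map f (JF_mat A)) = mset (map f (map fst n_as))" by (simp only: JF mset_map mset_rev mset_sort)
    then show ?thesis by (metis sum_mset_sum_list)
  qed
  have "similar_mat A (jordan_matrix n_as)" using jnf by (simp add: jordan_nf_def)
  then have "sum_list (map fst n_as) = n"
    using similar_matD[of A] A by (metis carrier_matD(1) insert_subset jordan_matrix_dim(1))
  then show "sum_list (JF_mat A) = n" using sum[of "\<lambda>m. m"] by simp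
  have "char_matrix A 0 = A" using A by (auto simp: char_matrix_def intro!: eq_matI)
  moreover have "filter (\<lambda>(m, a). a = 0) n_as = n_as"
    using nilpotent_jordan_nf_zero[OF assms jnf] by (auto simp: filter_id_conv)
  ultimately show "kernel_dim (A ^\<^sub>m k) = (\<Sum>m\<leftarrow>JF_mat A. min k m)"
    using dim_gen_eigenspace[OF jnf, of 0 k] by (simp add: dim_gen_eigenspace_def sum)
qed

section \<open>Partitions and dominance order\<close>

text \<open>Each of the first \<open>k\<close> parts is at most \<open>j + (x - min j x)\<close>;
  the additive form avoids truncated subtraction.\<close>

lemma sum_list_take_bound:
  fixes xs :: "nat list"
  shows "sum_list (take k xs) + (\<Sum>x\<leftarrow>xs. min j x) \<le> k * j + sum_list xs"
proof (induction xs arbitrary: k)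
  case (Cons x xs)
  show ?case
  proof (cases k)
    case 0
    have "(\<Sum>x\<leftarrow>xs. min j x) \<le> sum_list xs" using Cons.IH[of 0] by simp
    then show ?thesis using 0 by simp
  next
    case (Suc l)
    then show ?thesis using Cons.IH[of l] by simp
  qed
qed simp

text \<open>The bound on \<open>j\<close> is what later confines attention to finitely many kernel
  dimensions.\<close>

lemma sum_list_take_attained:
  fixes xs :: "nat list"
  assumes "sorted (rev xs)"
  shows "\<exists>j \<le> sum_list xs. sum_list (take k xs) + (\<Sum>x\<leftarrow>xs. min j x) = k * j + sum_list xs"
proof (cases "k < length xs")
  case True
  \<comment> \<open>The first part not taken: earlier parts are at least \<open>?j\<close> and later
    ones at most \<open>?j\<close>, so every estimate is sharp. If all parts are taken,
    \<open>j = 0\<close> does it.\<close>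
  let ?j = "xs ! k"
  have mono: "xs ! m \<le> xs ! l" if "l \<le> m" "m < length xs" for l m
    using sorted_rev_nth_mono[OF assms that] .
  have ge: "?j \<le> x" if "x \<in> set (take k xs)" for x
    using that mono True by (auto simp: in_set_conv_nth)
  have le: "x \<le> ?j" if "x \<in> set (drop k xs)" for x
    using that mono True by (auto simp: in_set_conv_nth)
  have "map (min ?j) (take k xs) = replicate k ?j"
    by (rule replicate_eqI) (use ge True in \<open>auto simp: min_absorb1\<close>)
  moreover have "map (min ?j) (drop k xs) = drop k xs"
    by (rule map_idI) (simp add: le min_absorb2)
  ultimately have "(\<Sum>x\<leftarrow>xs. min ?j x) = k * ?j + sum_list (drop k xs)"
    by (metis append_take_drop_id map_append sum_list_append sum_list_replicate mult.commute of_nat_id)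
  moreover have "sum_list xs = sum_list (take k xs) + sum_list (drop k xs)"
    by (metis append_take_drop_id sum_list_append)
  moreover have "?j \<le> sum_list xs" using True by (simp add: member_le_sum_list)
  ultimately show ?thesis by (intro exI[of _ ?j]) simp
next
  case False
  have "(\<Sum>x\<leftarrow>xs. min 0 x) = 0" by (induction xs) auto
  then show ?thesis using False by (intro exI[of _ 0]) simp
qed

text \<open>Partial sums of a partition are determined by the sizes of its truncations through
  \<open>x\<^sub>1 + \<dots> + x\<^sub>k = min\<^sub>j (k * j + \<Sum>i. (x\<^sub>i - min j x\<^sub>i))\<close>.\<close>

lemma dominance_leI:
  assumes "sorted (rev ys)" "sum_list xs = sum_list ys"
    and "\<And>j. j \<le> sum_list ys \<Longrightarrow> (\<Sum>y\<leftarrow>ys. min j y) \<le> (\<Sum>x\<leftarrow>xs. min j x)"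
  shows "dominance_le xs ys"
  unfolding dominance_le_def
proof
  fix k
  obtain j where j: "j \<le> sum_list ys" "sum_list (take k ys) + (\<Sum>y\<leftarrow>ys. min j y) = k * j + sum_list ys"
    using sum_list_take_attained[OF assms(1)] by blast
  then show "sum_list (take k xs) \<le> sum_list (take k ys)"
    using sum_list_take_bound[of k xs j] assms(2) assms(3)[OF j(1)] by linarith
qed

text \<open>Partial sums do not see trailing zeros, hence the conditions on 0.\<close>

lemma dominance_le_antisym:
  assumes "dominance_le xs ys" "dominance_le ys xs" "0 \<notin> set xs" "0 \<notin> set ys"
  shows "xs = ys"
proof -
  have "\<forall>k. sum_list (take k xs) = sum_list (take k ys)"
    using assms(1,2) by (auto simp: dominance_le_def intro: antisym)
  then show ?thesis using assms(3,4)
  proof (induction xs arbitrary: ys)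
    case Nil
    show ?case
    proof (cases ys)
      case (Cons y zs)
      then show ?thesis using Nil(1)[rule_format, of 1] Nil(3) by simp
    qed simp
  next
    case (Cons x xs)
    obtain y zs where ys: "ys = y # zs"
      using Cons.prems(1)[rule_format, of 1] Cons.prems(2) by (cases ys) auto
    have "x = y" using Cons.prems(1)[rule_format, of 1] ys by simp
    moreover have "\<forall>k. sum_list (take k xs) = sum_list (take k zs)"
      using Cons.prems(1)[rule_format, of "Suc _"] ys \<open>x = y\<close> by simp
    ultimately show ?case using Cons ys by simp
  qed
qed

section \<open>Irreducibility of the variety of nilpotent endomorphisms\<close>

text \<open>Over a finite field, 1 plus the product of all \<open>[:- a, 1:]\<close> takes the value
  1 everywhere.\<close>

lemma alg_closed_field_infinite:
  assumes "alg_closed_field TYPE('k::field)"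
  shows "infinite (UNIV :: 'k set)"
proof
  assume fin: "finite (UNIV :: 'k set)"
  define q where "q = (\<Prod>a\<in>(UNIV :: 'k set). [:- a, 1:])"
  have "degree q = card (UNIV :: 'k set)" unfolding q_def by (subst degree_prod_eq_sum_degree) auto
  then have "degree q > 0" using fin by (simp add: card_gt_0_iff)
  then have "degree (q + 1) > 0" by (subst degree_add_eq_left) auto
  then obtain x where "poly (q + 1) x = 0" using assms unfolding alg_closed_field_def by blast
  moreover have "poly q x = 0" unfolding q_def poly_prod using fin by (intro prod_zero) auto
  ultimately show False by simp
qed

lemma function_subalgebra_poly: "function_subalgebra (range (poly :: 'k::field poly \<Rightarrow> _))"
proof
  show "(\<lambda>_. c) \<in> range poly" for c :: 'k by (rule range_eqI[of _ _ "[:c:]"]) auto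
  fix f g :: "'k \<Rightarrow> 'k" assume "f \<in> range poly" "g \<in> range poly"
  then obtain p q where pq: "f = poly p" "g = poly q" by auto
  show "(\<lambda>x. f x + g x) \<in> range poly" by (rule range_eqI[of _ _ "p + q"]) (auto simp: pq)
  show "(\<lambda>x. f x * g x) \<in> range poly" by (rule range_eqI[of _ _ "p * q"]) (auto simp: pq)
qed

lemma function_subalgebra_poly_fun: "function_subalgebra (poly_fun n d)"
  by unfold_locales (rule poly_fun.intros; assumption?)+

lemma poly_fun_along_curve:
  assumes "p \<in> poly_fun n d"
    and N: "\<And>i r c. i < n \<Longrightarrow> r < d i \<Longrightarrow> c < d i \<Longrightarrow> (\<lambda>t. N t i $$ (r, c)) \<in> range poly"
  shows "(\<lambda>t. p (N t)) \<in> range poly"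
proof -
  interpret function_subalgebra "range (poly :: 'a poly \<Rightarrow> _)" by (rule function_subalgebra_poly)
  show ?thesis using assms(1) by induction (simp_all add: const add mult N)
qed

lemma smult_smult_mat: "a \<cdot>\<^sub>m (b \<cdot>\<^sub>m A) = (a * b :: 'a::semigroup_mult) \<cdot>\<^sub>m A"
  by (rule eq_matI) (simp_all add: mult.assoc)

lemma one_smult_mat: "1 \<cdot>\<^sub>m (A :: 'a::monoid_mult mat) = A"
  by (rule eq_matI) simp_all

text \<open>At an endpoint of the curve the inverse of \<open>g\<close> arises twice, from the given
  conjugation and from the adjugate; the two coincide.\<close>

lemma conj_inverse_cancel:
  fixes g h h' N :: "'k::field mat"
  assumes c: "g \<in> carrier_mat m m" "h \<in> carrier_mat m m" "h' \<in> carrier_mat m m" "N \<in> carrier_mat m m"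
    and inv: "g * h = 1\<^sub>m m" "h' * g = 1\<^sub>m m"
  shows "g * (h * N * g) * h' = N"
proof -
  have "h' * (g * h) = (h' * g) * h" using assoc_mult_mat[OF c(3,1,2)] by simp
  then have "h' = h" using inv c by simp
  have "g * (h * N * g) * h = (g * h) * N * (g * h)"
    using c by (simp add: assoc_mult_mat[of _ m m _ m _ m])
  then show ?thesis using inv c \<open>h' = h\<close> by simp
qed

lemma nilpotent_mat_conj:
  assumes "g \<in> carrier_mat m m" "h \<in> carrier_mat m m" "N \<in> carrier_mat m m"
    and "g * h = 1\<^sub>m m" "h * g = 1\<^sub>m m" "nilpotent_mat N"
  shows "nilpotent_mat (g * N * h)"
proof -
  have sim: "similar_mat_wit (g * N * h) N g h"
    by (rule similar_mat_witI[where n = m]) (use assms in auto)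
  obtain k where "N ^\<^sub>m k = 0\<^sub>m m m" using assms(3,6) by (auto simp: nilpotent_mat_def)
  then have "(g * N * h) ^\<^sub>m k = 0\<^sub>m m m"
    using similar_mat_wit_pow_id[OF sim, of k] assms by simp
  then show ?thesis using assms unfolding nilpotent_mat_def by auto
qed

lemma NEnd_carrier: "N \<in> NEnd n E src tgt d X \<Longrightarrow> i < n \<Longrightarrow> N i \<in> carrier_mat (d i) (d i)"
  by (auto simp: NEnd_def End_rep_def)

context
  fixes n :: nat and E :: "'e set" and src tgt :: "'e \<Rightarrow> nat" and d :: "nat \<Rightarrow> nat"
    and X :: "'e \<Rightarrow> 'k::field mat"
  assumes rep: "is_rep n E src tgt d X"
begin

text \<open>The adjugate formula is taken vertex by vertex, so compatibility with the arrows needs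
  an argument: \<open>h * X = h * X * g * h = h * g * X * h = X * h\<close>, with the components at
  target and source understood.\<close>

lemma End_rep_inverse:
  assumes g: "g \<in> End_rep n E src tgt d X"
    and h: "\<And>i. i < n \<Longrightarrow> h i \<in> carrier_mat (d i) (d i)" "\<And>i. \<not> i < n \<Longrightarrow> h i = 0\<^sub>m 0 0"
    and inv: "\<And>i. i < n \<Longrightarrow> g i * h i = 1\<^sub>m (d i)" "\<And>i. i < n \<Longrightarrow> h i * g i = 1\<^sub>m (d i)"
  shows "h \<in> End_rep n E src tgt d X"
proof -
  have "h (tgt e) * X e = X e * h (src e)" if e: "e \<in> E" for e
  proof -
    note s = rep_arrow(1)[OF rep e] and t = rep_arrow(2)[OF rep e] and Xe = rep_arrow(3)[OF rep e]
    note gs = End_repD(1)[OF g s] and gt = End_repD(1)[OF g t]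
    have "h (tgt e) * X e = h (tgt e) * (X e * (g (src e) * h (src e)))"
      using inv(1)[OF s] Xe by simp
    also have "\<dots> = h (tgt e) * (g (tgt e) * X e * h (src e))"
      using assoc_mult_mat[OF Xe gs h(1)[OF s]] End_repD(3)[OF g e] by simp
    also have "\<dots> = (h (tgt e) * g (tgt e)) * X e * h (src e)"
      using assoc_mult_mat[OF h(1)[OF t] gt Xe] assoc_mult_mat[OF h(1)[OF t] mult_carrier_mat[OF gt Xe] h(1)[OF s]]
      by simp
    finally show ?thesis using inv(2)[OF t] Xe by simp
  qed
  then show ?thesis using h by (auto simp: End_rep_def)
qed

lemma NEnd_conj:
  assumes g: "g \<in> End_rep n E src tgt d X" and h: "h \<in> End_rep n E src tgt d X"
    and inv: "\<And>i. i < n \<Longrightarrow> g i * h i = 1\<^sub>m (d i)" "\<And>i. i < n \<Longrightarrow> h i * g i = 1\<^sub>m (d i)"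
    and N: "N \<in> NEnd n E src tgt d X"
  shows "(\<lambda>i. g i * N i * h i) \<in> NEnd n E src tgt d X"
proof -
  have "N \<in> End_rep n E src tgt d X" using N by (simp add: NEnd_def)
  then have "(\<lambda>i. g i * N i * h i) \<in> End_rep n E src tgt d X" using g h by (simp add: End_rep_mult[OF rep])
  moreover have "nilpotent_mat (g i * N i * h i)" if "i < n" for i
    using that N g h inv by (intro nilpotent_mat_conj[of _ "d i"]) (auto simp: NEnd_def End_rep_def)
  ultimately show ?thesis by (simp add: NEnd_def)
qed

text \<open>Two nilpotent endomorphisms lie on a rational curve
  \<open>t \<mapsto> g t * a t * (g t)\<^sup>-\<^sup>1\<close> with \<open>a\<close> running through a line in a linear space of nilpotents
  and \<open>g\<close> through a line in the endomorphism algebra. Scaling \<open>a\<close> by the product \<open>\<delta>\<close> of the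
  determinants of the \<open>g t i\<close> clears denominators.\<close>

lemma NEnd_irreducible:
  assumes inf: "infinite (UNIV :: 'k set)"
    and p: "p \<in> poly_fun n d" and q: "q \<in> poly_fun n d"
    and N1: "N1 \<in> NEnd n E src tgt d X" "p N1 \<noteq> 0" and N2: "N2 \<in> NEnd n E src tgt d X" "q N2 \<noteq> 0"
  shows "\<exists>N \<in> NEnd n E src tgt d X. p N \<noteq> 0 \<and> q N \<noteq> 0"
proof -
  let ?End = "End_rep n E src tgt d X" and ?NEnd = "NEnd n E src tgt d X"
  obtain U where U: "U \<subseteq> ?NEnd" "\<And>N M. N \<in> U \<Longrightarrow> M \<in> U \<Longrightarrow> (\<lambda>i. N i + M i) \<in> U"
    "\<And>c N. N \<in> U \<Longrightarrow> (\<lambda>i. c \<cdot>\<^sub>m N i) \<in> U"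
    and conj: "\<And>N. N \<in> ?NEnd \<Longrightarrow> \<exists>g\<in>?End. \<exists>h\<in>?End.
       (\<forall>i<n. g i * h i = 1\<^sub>m (d i) \<and> h i * g i = 1\<^sub>m (d i)) \<and> (\<lambda>i. h i * N i * g i) \<in> U"
    by (rule NEnd_conj_into_subspace[OF rep]) (rule that; assumption)
  obtain g1 h1 where g1: "g1 \<in> ?End" "h1 \<in> ?End" "\<And>i. i < n \<Longrightarrow> g1 i * h1 i = 1\<^sub>m (d i)"
    "(\<lambda>i. h1 i * N1 i * g1 i) \<in> U" using conj[OF N1(1)] by blast
  obtain g2 h2 where g2: "g2 \<in> ?End" "h2 \<in> ?End" "\<And>i. i < n \<Longrightarrow> g2 i * h2 i = 1\<^sub>m (d i)"
    "(\<lambda>i. h2 i * N2 i * g2 i) \<in> U" using conj[OF N2(1)] by blast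
  define a1 a2 where "a1 i = h1 i * N1 i * g1 i" and "a2 i = h2 i * N2 i * g2 i" for i
  have aU: "a1 \<in> U" "a2 \<in> U" using g1(4) g2(4) by (simp_all add: a1_def[abs_def] a2_def[abs_def])
  define g where "g t i = (1 - t) \<cdot>\<^sub>m g1 i + t \<cdot>\<^sub>m g2 i" for t i
  define \<delta> where "\<delta> t = (\<Prod>i<n. det (g t i))" for t
  \<comment> \<open>The extra product gives \<open>g t i * G t i\<close> the same scalar
    \<open>\<delta> t\<close> at every vertex. A common scalar is needed because \<open>U\<close> is
    closed under scaling all components at once.\<close>
  define G where "G t i = (\<Prod>j\<in>{..<n} - {i}. det (g t j)) \<cdot>\<^sub>m adj_mat (g t i)" for t i
  \<comment> \<open>Normalised so that \<open>\<delta> t\<close> times \<open>a t\<close> is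
    \<open>a1\<close> at \<open>t = 0\<close> and \<open>a2\<close> at \<open>t = 1\<close>; hence
    the curve \<open>N\<close> passes through \<open>N1\<close> and \<open>N2\<close>.\<close>
  define a where "a t i = ((1 - t) * inverse (\<delta> 0)) \<cdot>\<^sub>m a1 i + (t * inverse (\<delta> 1)) \<cdot>\<^sub>m a2 i" for t i
  define N where "N t i = g t i * a t i * G t i" for t i
  define h where "h t i = inverse (\<delta> t) \<cdot>\<^sub>m G t i" for t i

  have gE: "g t \<in> ?End" for t
    unfolding g_def using End_rep_add[OF rep End_rep_smult[OF rep g1(1)] End_rep_smult[OF rep g2(1)]] .
  have aU': "a t \<in> U" for t unfolding a_def[abs_def] by (intro U(2,3) aU)
  have aN: "(\<lambda>i. c \<cdot>\<^sub>m a t i) \<in> ?NEnd" for c t using U(1) U(3)[OF aU'] by blast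
  have gc: "g t i \<in> carrier_mat (d i) (d i)" if "i < n" for t i using End_repD(1)[OF gE that] .
  have ac: "a t i \<in> carrier_mat (d i) (d i)" "a1 i \<in> carrier_mat (d i) (d i)" "a2 i \<in> carrier_mat (d i) (d i)"
    if "i < n" for t i using NEnd_carrier[OF _ that] aU' aU U(1) by blast+
  have Gc: "G t i \<in> carrier_mat (d i) (d i)" if "i < n" for t i
    unfolding G_def using adj_mat(1)[OF gc[OF that]] by simp
  have \<delta>: "\<delta> t = (\<Prod>j\<in>{..<n} - {i}. det (g t j)) * det (g t i)" if "i < n" for t i
    unfolding \<delta>_def using that prod.remove[of "{..<n}" i "\<lambda>i. det (g t i)"] by (simp add: mult.commute)
  have gG: "g t i * G t i = \<delta> t \<cdot>\<^sub>m 1\<^sub>m (d i)" "G t i * g t i = \<delta> t \<cdot>\<^sub>m 1\<^sub>m (d i)" if "i < n" for t i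
    unfolding G_def \<delta>[OF that] using gc[OF that] adj_mat[OF gc[OF that]]
    by (simp_all add: mult_smult_distrib[of _ "d i" "d i" _ "d i"] mult_smult_assoc_mat[of _ "d i" "d i" _ "d i"] smult_smult_mat one_smult_mat)
  have hc: "h t i \<in> carrier_mat (d i) (d i)" if "i < n" for t i unfolding h_def using Gc[OF that] by simp
  have gh: "g t i * h t i = 1\<^sub>m (d i)" "h t i * g t i = 1\<^sub>m (d i)" if "i < n" "\<delta> t \<noteq> 0" for t i
    unfolding h_def using gc[OF that(1)] Gc[OF that(1)] gG[OF that(1)] that(2)
    by (simp_all add: mult_smult_distrib[of _ "d i" "d i" _ "d i"] mult_smult_assoc_mat[of _ "d i" "d i" _ "d i"] smult_smult_mat one_smult_mat)
  have out: "g t i = 0\<^sub>m 0 0" "a t i = 0\<^sub>m 0 0" "G t i = 0\<^sub>m 0 0" if "\<not> i < n" for t i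
  proof -
    show g0: "g t i = 0\<^sub>m 0 0" using End_repD(2)[OF gE that] .
    have "a t \<in> ?End" using aU'[of t] U(1) unfolding NEnd_def by blast
    then show "a t i = 0\<^sub>m 0 0" using End_repD(2) that by blast
    show "G t i = 0\<^sub>m 0 0" unfolding G_def g0 by (rule eq_matI) (auto simp: adj_mat_def)
  qed
  have hE: "h t \<in> ?End" if "\<delta> t \<noteq> 0" for t
    by (rule End_rep_inverse[OF gE]) (use gh that hc in \<open>auto simp: h_def out\<close>)
  have N_eq: "N t i = g t i * (\<delta> t \<cdot>\<^sub>m a t i) * h t i" if "i < n" "\<delta> t \<noteq> 0" for t i
    unfolding N_def h_def using gc[OF that(1), of t] ac(1)[OF that(1), of t] Gc[OF that(1), of t] that(2)
    by (simp add: mult_smult_distrib[of _ "d i" "d i" _ "d i"] mult_smult_assoc_mat[of _ "d i" "d i" _ "d i"] smult_smult_mat one_smult_mat)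
  have N_NEnd: "N t \<in> ?NEnd" if "\<delta> t \<noteq> 0" for t
  proof -
    have "N t = (\<lambda>i. g t i * (\<delta> t \<cdot>\<^sub>m a t i) * h t i)"
    proof
      fix i show "N t i = g t i * (\<delta> t \<cdot>\<^sub>m a t i) * h t i"
        using N_eq[OF _ that] by (cases "i < n") (auto simp: N_def out h_def)
    qed
    then show ?thesis using NEnd_conj[OF gE hE[OF that] gh(1)[OF _ that] gh(2)[OF _ that] aN] by simp
  qed
  have g01: "g 0 i = g1 i" "g 1 i = g2 i" if "i < n" for i
    using that End_repD(1)[OF g1(1) that] End_repD(1)[OF g2(1) that] unfolding g_def by auto
  have det_nz: "det x \<noteq> 0" if "x * y = 1\<^sub>m m" "x \<in> carrier_mat m m" "y \<in> carrier_mat m m" for x y :: "'k mat" and m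
    using det_mult[OF that(2,3)] that(1) by auto
  have "det (g 0 i) \<noteq> 0" "det (g 1 i) \<noteq> 0" if "i < n" for i
    using det_nz[OF g1(3)[OF that] End_repD(1)[OF g1(1) that] End_repD(1)[OF g1(2) that]]
      det_nz[OF g2(3)[OF that] End_repD(1)[OF g2(1) that] End_repD(1)[OF g2(2) that]]
      g01[OF that] by simp_all
  then have \<delta>01: "\<delta> 0 \<noteq> 0" "\<delta> 1 \<noteq> 0" by (simp_all add: \<delta>_def)
  have a01: "\<delta> 0 \<cdot>\<^sub>m a 0 i = a1 i" "\<delta> 1 \<cdot>\<^sub>m a 1 i = a2 i" if "i < n" for i
    using ac(2,3)[OF that] \<delta>01 unfolding a_def by (auto intro!: eq_matI)
  have "N 0 i = N1 i" "N 1 i = N2 i" if "i < n" for i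
    using N_eq[OF that \<delta>01(1)] N_eq[OF that \<delta>01(2)] a01[OF that] gh(2)[OF that \<delta>01(1)] gh(2)[OF that \<delta>01(2)]
      conj_inverse_cancel[OF End_repD(1)[OF g1(1) that] End_repD(1)[OF g1(2) that] hc[OF that] NEnd_carrier[OF N1(1) that] g1(3)[OF that]]
      conj_inverse_cancel[OF End_repD(1)[OF g2(1) that] End_repD(1)[OF g2(2) that] hc[OF that] NEnd_carrier[OF N2(1) that] g2(3)[OF that]]
    by (simp_all add: g01[OF that] a1_def a2_def)
  moreover have "N t i = 0\<^sub>m 0 0" "N1 i = 0\<^sub>m 0 0" "N2 i = 0\<^sub>m 0 0" if "\<not> i < n" for t i
    using that N1(1) N2(1) by (auto simp: N_def out NEnd_def End_rep_def)
  ultimately have N01: "N 0 = N1" "N 1 = N2" by (intro ext; metis)+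

  interpret P: function_subalgebra "range (poly :: 'k poly \<Rightarrow> _)" by (rule function_subalgebra_poly)
  have t: "(\<lambda>t. t) \<in> range (poly :: 'k poly \<Rightarrow> _)" by (rule range_eqI[of _ _ "[:0, 1:]"]) auto
  have t': "(\<lambda>t. 1 - t) \<in> range (poly :: 'k poly \<Rightarrow> _)" by (rule range_eqI[of _ _ "[:1, - 1:]"]) auto
  have g_poly: "P.entries (d i) (d i) (\<lambda>t. g t i)" if "i < n" for i
    unfolding g_def using End_repD(1)[OF g1(1) that] End_repD(1)[OF g2(1) that]
    by (intro P.entries_add P.entries_smult P.entries_const t t')
  have a_poly: "P.entries (d i) (d i) (\<lambda>t. a t i)" if "i < n" for i
    unfolding a_def using ac(2,3)[OF that]
    by (intro P.entries_add P.entries_smult P.entries_const P.mult P.const t t')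
  have det_poly: "(\<lambda>t. det (g t j)) \<in> range poly" if "j < n" for j
    using P.det[OF g_poly[OF that]] .
  have G_poly: "P.entries (d i) (d i) (\<lambda>t. G t i)" if "i < n" for i
    unfolding G_def using that
    by (intro P.entries_smult P.entries_adj_mat P.prod det_poly g_poly) auto
  have "P.entries (d i) (d i) (\<lambda>t. N t i)" if "i < n" for i
    unfolding N_def by (rule P.entries_mult[OF P.entries_mult[OF g_poly a_poly] G_poly]) (rule that)+
  then have N_poly: "(\<lambda>t. N t i $$ (r, c)) \<in> range poly" if "i < n" "r < d i" "c < d i" for i r c
    using that P.entriesD(2) by blast
  obtain P1 P2 where "(\<lambda>t. p (N t)) = poly P1" "(\<lambda>t. q (N t)) = poly P2"
    using poly_fun_along_curve[where N = N, OF p N_poly] poly_fun_along_curve[where N = N, OF q N_poly] by blast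
  then have P1: "p (N t) = poly P1 t" and P2: "q (N t) = poly P2 t" for t by (auto dest: fun_cong)
  have "\<delta> \<in> range poly" unfolding \<delta>_def[abs_def] by (intro P.prod det_poly) auto
  then obtain P3 where P3: "\<And>t. \<delta> t = poly P3 t" by auto
  \<comment> \<open>None of the three polynomials is zero, so a parameter off the finitely many
    roots of their product gives a point of the variety where both functions are nonzero.\<close>
  have "poly P1 0 \<noteq> 0" "poly P2 1 \<noteq> 0" "poly P3 0 \<noteq> 0"
    using P1[of 0] P2[of 1] P3[of 0] N01 N1(2) N2(2) \<delta>01 by simp_all
  then have "P1 * P2 * P3 \<noteq> 0" by (metis mult_eq_0_iff poly_0)
  then have "finite {t. poly (P1 * P2 * P3) t = 0}" by (rule poly_roots_finite)
  then obtain t where "poly (P1 * P2 * P3) t \<noteq> 0" using inf by (metis (mono_tags) UNIV_eq_I mem_Collect_eq)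
  then show ?thesis using N_NEnd[of t] P1[of t] P2[of t] P3[of t] by (intro bexI[of _ "N t"]) auto
qed

lemma NEnd_generic_point:
  assumes inf: "infinite (UNIV :: 'k set)" and "finite I" and "NEnd n E src tgt d X \<noteq> {}"
    and "\<And>x. x \<in> I \<Longrightarrow> p x \<in> poly_fun n d" "\<And>x. x \<in> I \<Longrightarrow> \<exists>N \<in> NEnd n E src tgt d X. p x N \<noteq> 0"
  shows "\<exists>N \<in> NEnd n E src tgt d X. \<forall>x\<in>I. p x N \<noteq> 0"
  using assms(2,4,5)
proof induction
  case empty
  then show ?case using assms(3) by auto
next
  case (insert x I)
  interpret function_subalgebra "poly_fun n d :: ((nat \<Rightarrow> 'k mat) \<Rightarrow> 'k) set" by (rule function_subalgebra_poly_fun)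
  obtain N where N: "N \<in> NEnd n E src tgt d X" "\<forall>x\<in>I. p x N \<noteq> 0" using insert by auto
  obtain M where M: "M \<in> NEnd n E src tgt d X" "p x M \<noteq> 0" using insert.prems by auto
  have "(\<lambda>N. \<Prod>x\<in>I. p x N) \<in> poly_fun n d" using insert.prems by (intro prod) auto
  moreover have "(\<Prod>x\<in>I. p x N) \<noteq> 0" using N insert.hyps by simp
  ultimately obtain L where "L \<in> NEnd n E src tgt d X" "(\<Prod>x\<in>I. p x L) \<noteq> 0" "p x L \<noteq> 0"
    using NEnd_irreducible[where p = "\<lambda>N. \<Prod>x\<in>I. p x N" and q = "p x", OF inf _ _ N(1) _ M] insert.prems(1) by blast
  then show ?case using insert.hyps by (intro bexI[of _ L]) auto
qed

end

section \<open>Open conditions and the Zariski topology\<close>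

text \<open>Matrices \<open>U\<close> and \<open>V\<close> detecting the rank at \<open>N\<close>
  are kept fixed; the same determinant at \<open>M\<close> bounds the kernel there.\<close>

lemma kernel_dim_power_upper_semicontinuous:
  assumes "N \<in> NEnd n E src tgt d X" "i < n"
  shows "\<exists>p \<in> poly_fun n d. p N \<noteq> 0 \<and>
    (\<forall>M \<in> NEnd n E src tgt d X. p M \<noteq> 0 \<longrightarrow> kernel_dim (M i ^\<^sub>m j) \<le> kernel_dim (N i ^\<^sub>m j))"
proof -
  interpret function_subalgebra "poly_fun n d :: ((nat \<Rightarrow> 'a mat) \<Rightarrow> 'a) set" by (rule function_subalgebra_poly_fun)
  \<comment> \<open>Forces the right size for every argument, since a function outside the variety
    may have components of any size.\<close>
  define m where "m M = mat (d i) (d i) (\<lambda>(r, c). M i $$ (r, c))" for M :: "nat \<Rightarrow> 'a mat"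
  have m: "m M = M i" if "M \<in> NEnd n E src tgt d X" for M
    using NEnd_carrier[OF that assms(2)] by (auto simp: m_def)
  have "entries (d i) (d i) m"
    unfolding m_def by (rule entries_cong[where m = "\<lambda>r c M. M i $$ (r, c)"]) (use poly_fun.coord[OF assms(2)] in auto)
  then have mj: "entries (d i) (d i) (\<lambda>M. m M ^\<^sub>m j)" by (rule entries_power)
  have Nc: "N i ^\<^sub>m j \<in> carrier_mat (d i) (d i)" using NEnd_carrier[OF assms] by simp
  obtain r U V where UV: "U \<in> carrier_mat r (d i)" "V \<in> carrier_mat (d i) r"
    "det (U * N i ^\<^sub>m j * V) \<noteq> 0" "kernel_dim (N i ^\<^sub>m j) = d i - r"
    by (rule kernel_dim_minor_exists[OF Nc]) (rule that; assumption)
  define p where "p M = det (U * m M ^\<^sub>m j * V)" for M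
  have "p \<in> poly_fun n d"
    unfolding p_def[abs_def] by (intro det[where n = r] entries_mult[OF entries_mult[OF entries_const mj] entries_const] UV)
  moreover have "p N \<noteq> 0" using UV m[OF assms(1)] by (simp add: p_def)
  moreover have "kernel_dim (M i ^\<^sub>m j) \<le> kernel_dim (N i ^\<^sub>m j)"
    if "M \<in> NEnd n E src tgt d X" "p M \<noteq> 0" for M
    using kernel_dim_le_of_minor[OF _ UV(1,2), of "M i ^\<^sub>m j"] that m[OF that(1)] UV(4) NEnd_carrier[OF that(1) assms(2)]
    by (simp add: p_def)
  ultimately show ?thesis by blast
qed

lemma openin_zariski_basic: "p \<in> poly_fun n d \<Longrightarrow> openin (zariski n d) {N. p N \<noteq> 0}"
  unfolding zariski_def by (rule topology_generated_by_Basis) auto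

lemma topspace_zariski: "topspace (zariski n d) = UNIV"
  using openin_subset[OF openin_zariski_basic[OF poly_fun.const[of 1]]] by auto

text \<open>The generating sets form a basis, as a finite intersection is the nonvanishing set of a
  product.\<close>

lemma zariski_basic_nbhd:
  assumes "openin (zariski n d) T" "N \<in> T"
  shows "\<exists>p \<in> poly_fun n d. p N \<noteq> 0 \<and> {M. p M \<noteq> 0} \<subseteq> T"
proof -
  have "generate_topology_on {{N. p N \<noteq> 0} | p. p \<in> poly_fun n d} T"
    using assms(1) unfolding zariski_def openin_topology_generated_by_iff .
  then show ?thesis using assms(2)
  proof induction
    case (Int A B)
    then obtain p q where "p \<in> poly_fun n d" "q \<in> poly_fun n d" "p N \<noteq> 0" "q N \<noteq> 0"
      "{M. p M \<noteq> 0} \<subseteq> A" "{M. q M \<noteq> 0} \<subseteq> B" by blast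
    then show ?case by (intro bexI[of _ "\<lambda>N. p N * q N"] poly_fun.mult) auto
  next
    case (UN K)
    then obtain k where k: "k \<in> K" "N \<in> k" by blast
    obtain p where "p \<in> poly_fun n d" "p N \<noteq> 0" "{M. p M \<noteq> 0} \<subseteq> k" using UN.IH[OF k] by blast
    then show ?case using k(1) by (intro bexI[of _ p]) auto
  next
    case (Basis s)
    then obtain p where "p \<in> poly_fun n d" "s = {N. p N \<noteq> 0}" by auto
    then show ?case using Basis.prems by (intro bexI[of _ p]) auto
  qed simp
qed

theorem theorem2p3:
  fixes n :: nat and E :: "'e set" and src tgt :: "'e \<Rightarrow> nat" and d :: "nat \<Rightarrow> nat"
    and X :: "'e \<Rightarrow> 'k::field mat"
  assumes "alg_closed_field TYPE('k)"
    and "is_rep n E src tgt d X"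
  shows "\<exists>\<mu>. (\<exists>N0 \<in> NEnd n E src tgt d X. JF n N0 = \<mu>)
          \<and> (\<forall>N \<in> NEnd n E src tgt d X. dominance_le_tuple n (JF n N) \<mu>)
          \<and> openin (subtopology (zariski n d) (NEnd n E src tgt d X))
                   {N \<in> NEnd n E src tgt d X. JF n N = \<mu>}
          \<and> (subtopology (zariski n d) (NEnd n E src tgt d X)) closure_of
                   {N \<in> NEnd n E src tgt d X. JF n N = \<mu>} = NEnd n E src tgt d X"
proof -
  let ?NEnd = "NEnd n E src tgt d X"
  define I where "I = (SIGMA i:{..<n}. {..d i})"
  have fin: "finite I" unfolding I_def by (intro finite_SigmaI) auto
  define K where "K N = (\<lambda>(i, j). kernel_dim (N i ^\<^sub>m j))" for N :: "nat \<Rightarrow> 'k mat"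
  \<comment> \<open>The points where all relevant kernel dimensions are minimal simultaneously; that
    they exist is part of the density claim.\<close>
  define Gen where "Gen = {N \<in> ?NEnd. \<forall>x\<in>I. \<forall>M\<in>?NEnd. K N x \<le> K M x}"
  interpret function_subalgebra "poly_fun n d :: ((nat \<Rightarrow> 'k mat) \<Rightarrow> 'k) set" by (rule function_subalgebra_poly_fun)
  have inf: "infinite (UNIV :: 'k set)" using assms(1) by (rule alg_closed_field_infinite)
  have "nilpotent_mat (0\<^sub>m m m :: 'k mat)" for m
    unfolding nilpotent_mat_def by (rule exI[of _ 1]) simp
  then have ne: "?NEnd \<noteq> {}" using End_rep_zero[OF assms(2)] by (auto simp: NEnd_def)
  have semi: "\<exists>p \<in> poly_fun n d. p N \<noteq> 0 \<and> (\<forall>M\<in>?NEnd. p M \<noteq> 0 \<longrightarrow> K M x \<le> K N x)"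
    if "N \<in> ?NEnd" "x \<in> I" for N x
    using kernel_dim_power_upper_semicontinuous[OF that(1)] that(2) by (auto simp: I_def K_def)

  have dense: "\<exists>N\<in>Gen. q N \<noteq> 0" if q: "q \<in> poly_fun n d" "N \<in> ?NEnd" "q N \<noteq> 0" for q N
  proof -
    have "\<exists>N\<in>?NEnd. \<forall>M\<in>?NEnd. K N x \<le> K M x" for x
      using ne ex_has_least_nat[of "\<lambda>N. N \<in> ?NEnd" _ "\<lambda>N. K N x"] by blast
    then obtain m where m: "\<And>x. m x \<in> ?NEnd" "\<And>x M. M \<in> ?NEnd \<Longrightarrow> K (m x) x \<le> K M x" by metis
    then have "\<forall>x\<in>I. \<exists>p \<in> poly_fun n d. p (m x) \<noteq> 0 \<and> (\<forall>M\<in>?NEnd. p M \<noteq> 0 \<longrightarrow> K M x \<le> K (m x) x)"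
      using semi by blast
    then obtain p where p: "\<And>x. x \<in> I \<Longrightarrow> p x \<in> poly_fun n d" "\<And>x. x \<in> I \<Longrightarrow> p x (m x) \<noteq> 0"
      "\<And>x M. x \<in> I \<Longrightarrow> M \<in> ?NEnd \<Longrightarrow> p x M \<noteq> 0 \<Longrightarrow> K M x \<le> K (m x) x"
      by metis
    have "\<exists>N\<in>?NEnd. p x N \<noteq> 0" if "x \<in> I" for x using p(2)[OF that] m(1) by blast
    then obtain L where L: "L \<in> ?NEnd" "\<forall>x\<in>I. p x L \<noteq> 0"
      using NEnd_generic_point[where p = p, OF assms(2) inf fin ne p(1)] by blast
    \<comment> \<open>Each \<open>m x\<close> is minimal for its own index only, and
      \<open>q\<close> may vanish at \<open>L\<close>. But \<open>L\<close> shows that the product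
      is nonzero somewhere, so irreducibility can combine it with \<open>q\<close>.\<close>
    have "(\<Prod>x\<in>I. p x L) \<noteq> 0" using L fin by simp
    moreover have "(\<lambda>N. \<Prod>x\<in>I. p x N) \<in> poly_fun n d" using p(1) by (rule prod)
    ultimately obtain N' where N': "N' \<in> ?NEnd" "q N' \<noteq> 0" "(\<Prod>x\<in>I. p x N') \<noteq> 0"
      using NEnd_irreducible[where p = q and q = "\<lambda>N. \<Prod>x\<in>I. p x N", OF assms(2) inf q(1) _ q(2,3) L(1)] by blast
    then have "\<forall>x\<in>I. p x N' \<noteq> 0" using fin by simp
    then have "N' \<in> Gen" using N'(1) p(3) m(2) unfolding Gen_def by (blast intro: order.trans)
    then show ?thesis using N'(2) by blast
  qed

  have "open": "\<exists>p \<in> poly_fun n d. p N \<noteq> 0 \<and> (\<forall>M\<in>?NEnd. p M \<noteq> 0 \<longrightarrow> M \<in> Gen)" if N: "N \<in> Gen" for N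
  proof -
    have NE: "N \<in> ?NEnd" using N by (simp add: Gen_def)
    then obtain p where p: "\<And>x. x \<in> I \<Longrightarrow> p x \<in> poly_fun n d" "\<And>x. x \<in> I \<Longrightarrow> p x N \<noteq> 0"
      "\<And>x M. x \<in> I \<Longrightarrow> M \<in> ?NEnd \<Longrightarrow> p x M \<noteq> 0 \<Longrightarrow> K M x \<le> K N x"
      using semi[OF NE] by metis
    have "(\<lambda>N. \<Prod>x\<in>I. p x N) \<in> poly_fun n d" using p(1) by (rule prod)
    moreover have "(\<Prod>x\<in>I. p x N) \<noteq> 0" using p(2) fin by simp
    moreover have "M \<in> Gen" if "M \<in> ?NEnd" "(\<Prod>x\<in>I. p x M) \<noteq> 0" for M
    proof -
      have "\<forall>x\<in>I. p x M \<noteq> 0" using that(2) fin by simp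
      then show ?thesis using that(1) p(3) N unfolding Gen_def by (blast intro: order.trans)
    qed
    ultimately show ?thesis by (intro bexI[of _ "\<lambda>N. \<Prod>x\<in>I. p x N"] conjI ballI impI)
  qed

  obtain N0 where N0: "N0 \<in> Gen" using dense[OF poly_fun.const[of 1]] ne by auto
  have nil: "nilpotent_mat (N i)" if "N \<in> ?NEnd" "i < n" for N i using that by (simp add: NEnd_def)
  note props = JF_mat_props[OF NEnd_carrier nil]
  have K: "K N (i, j) = (\<Sum>m\<leftarrow>JF_mat (N i). min j m)" if "N \<in> ?NEnd" "i < n" for N i j
    using props(4)[OF that that] by (simp add: K_def)
  have dom: "dominance_le (JF_mat (N i)) (JF_mat (M i))" if "N \<in> ?NEnd" "M \<in> Gen" "i < n" for N M i
  proof (rule dominance_leI)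
    have M: "M \<in> ?NEnd" using that by (simp add: Gen_def)
    show "sorted (rev (JF_mat (M i)))" "sum_list (JF_mat (N i)) = sum_list (JF_mat (M i))"
      using props(1,3)[OF M that(3) M that(3)] props(3)[OF that(1,3) that(1,3)] by simp_all
    fix j assume "j \<le> sum_list (JF_mat (M i))"
    then have "(i, j) \<in> I" using props(3)[OF M that(3) M that(3)] that(3) by (simp add: I_def)
    then have "K M (i, j) \<le> K N (i, j)" using that by (auto simp: Gen_def)
    then show "(\<Sum>m\<leftarrow>JF_mat (M i). min j m) \<le> (\<Sum>m\<leftarrow>JF_mat (N i). min j m)"
      using K[OF M that(3)] K[OF that(1,3)] by simp
  qed
  \<comment> \<open>Equal Jordan types have equal kernel dimensions; conversely, two points of
    \<open>Gen\<close> dominate each other at every vertex.\<close>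
  have Gen_eq: "{N \<in> ?NEnd. JF n N = JF n N0} = Gen"
  proof (intro equalityI subsetI)
    fix N assume "N \<in> {N \<in> ?NEnd. JF n N = JF n N0}"
    then have N: "N \<in> ?NEnd" "JF n N = JF n N0" by auto
    have "JF_mat (N i) = JF_mat (N0 i)" if "i < n" for i using fun_cong[OF N(2), of i] that by (simp add: JF_def)
    then have "K N x = K N0 x" if "x \<in> I" for x
      using that K[OF N(1)] K[of N0] N0 by (auto simp: I_def Gen_def)
    then show "N \<in> Gen" using N(1) N0 by (simp add: Gen_def)
  next
    fix N assume N: "N \<in> Gen"
    have NE: "N \<in> ?NEnd" "N0 \<in> ?NEnd" using N N0 by (simp_all add: Gen_def)
    have "JF_mat (N i) = JF_mat (N0 i)" if "i < n" for i
      using dom[OF NE(1) N0 that] dom[OF NE(2) N that] props(2)[OF NE(1) that NE(1) that] props(2)[OF NE(2) that NE(2) that]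
      by (rule dominance_le_antisym)
    then show "N \<in> {N \<in> ?NEnd. JF n N = JF n N0}" using NE by (auto simp: JF_def)
  qed
  have "openin (subtopology (zariski n d) ?NEnd) Gen"
  proof (subst openin_subopen, intro ballI)
    fix N assume N: "N \<in> Gen"
    then obtain p where p: "p \<in> poly_fun n d" "p N \<noteq> 0" "\<forall>M\<in>?NEnd. p M \<noteq> 0 \<longrightarrow> M \<in> Gen"
      using "open" by blast
    have "openin (subtopology (zariski n d) ?NEnd) (?NEnd \<inter> {N. p N \<noteq> 0})"
      using openin_zariski_basic[OF p(1)] by (rule openin_subtopology_Int2)
    moreover have "N \<in> ?NEnd \<inter> {N. p N \<noteq> 0}" using N p(2) by (simp add: Gen_def)
    moreover have "?NEnd \<inter> {N. p N \<noteq> 0} \<subseteq> Gen" using p(3) by blast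
    ultimately show "\<exists>T. openin (subtopology (zariski n d) ?NEnd) T \<and> N \<in> T \<and> T \<subseteq> Gen" by blast
  qed
  moreover have "subtopology (zariski n d) ?NEnd closure_of Gen = ?NEnd"
  proof (intro equalityI subsetI)
    fix N assume "N \<in> subtopology (zariski n d) ?NEnd closure_of Gen"
    then show "N \<in> ?NEnd" using closure_of_subset_topspace[of "subtopology (zariski n d) ?NEnd"] by (auto simp: topspace_zariski)
  next
    fix N assume N: "N \<in> ?NEnd"
    have "\<exists>y. y \<in> Gen \<and> y \<in> T" if T: "N \<in> T" "openin (subtopology (zariski n d) ?NEnd) T" for T
    proof -
      obtain T' where T': "openin (zariski n d) T'" "T = T' \<inter> ?NEnd" using T(2) by (auto simp: openin_subtopology)
      then obtain p where p: "p \<in> poly_fun n d" "p N \<noteq> 0" "{M. p M \<noteq> 0} \<subseteq> T'"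
        using zariski_basic_nbhd[of n d T' N] T(1) by blast
      obtain L where "L \<in> Gen" "p L \<noteq> 0" using dense[OF p(1) N p(2)] by blast
      then have "L \<in> Gen \<and> L \<in> T" using p(3) T'(2) by (auto simp: Gen_def)
      then show ?thesis by blast
    qed
    then show "N \<in> subtopology (zariski n d) ?NEnd closure_of Gen"
      using N by (auto simp: in_closure_of topspace_zariski)
  qed
  moreover have "\<forall>N\<in>?NEnd. dominance_le_tuple n (JF n N) (JF n N0)"
    using dom[OF _ N0] by (simp add: dominance_le_tuple_def JF_def)
  moreover have "\<exists>N1\<in>?NEnd. JF n N1 = JF n N0" using N0 by (auto simp: Gen_def)
  ultimately show ?thesis using Gen_eq by (intro exI[of _ "JF n N0"]) simp
qed

end
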